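(* Let $t\in[0,T)$, $\gamma>0$, let the standing assumptions on the coefficients (given in the context) hold, and let $(\Pi,P)\in C([t,T]\times\mathcal S;\mathbb S^n)\times C([t,T]\times\mathcal S;\mathbb S^n)$ be a solution of the coupled Riccati equations in the context satisfying $\hat{\mathcal R}_{11}(s,i)\gg0$ and $\hat{\mathcal R}_{22}(s,i)\ll0$ for a.e. $s\in[t,T]$ and all $i\in\mathcal S$. Consider the two backward ordinary differential equations for $\eta,\bar\eta:[t,T]\times\mathcal S\to\mathbb R^n$ (argument $(s,i)$ suppressed, $i\in\mathcal S$, a.e. $s\in[t,T]$): $$\dot\eta+A^\top\eta-\hat{\mathcal S}_2^\top\hat{\mathcal R}_{22}^{-1}\psi-\big(\hat{\mathcal S}_1-\hat{\mathcal R}_{12}\hat{\mathcal R}_{22}^{-1}\hat{\mathcal S}_2\big)^\top\big(\hat{\mathcal R}_{11}-\hat{\mathcal R}_{12}\hat{\mathcal R}_{22}^{-1}\hat{\mathcal R}_{12}^\top\big)^{-1}\varphi+C^\top P\sigma+\bar C^\top\Pi\bar\sigma+Pb+q+\sum_{j=1}^D\lambda_{ij}\eta(s,j)=0,\quad \eta(T,i)=g(T,i),$$ $$\dot{\bar\eta}+A^\top\bar\eta-\hat{\mathcal S}_1^\top\hat{\mathcal R}_{11}^{-1}\bar\psi-\big(\hat{\mathcal S}_2-\hat{\mathcal R}_{12}^\top\hat{\mathcal R}_{11}^{-1}\hat{\mathcal S}_1\big)^\top\big(\hat{\mathcal R}_{22}-\hat{\mathcal R}_{12}^\top\hat{\mathcal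 R}_{11}^{-1}\hat{\mathcal R}_{12}\big)^{-1}\bar\varphi+C^\top P\sigma+\bar C^\top\Pi\bar\sigma+Pb+q+\sum_{j=1}^D\lambda_{ij}\bar\eta(s,j)=0,\quad \bar\eta(T,i)=g(T,i),$$ where $$\psi:=B_2^\top\eta+D_2^\top P\sigma+\bar D_2^\top\Pi\bar\sigma+\rho_2,\qquad \varphi:=B_1^\top\eta+D_1^\top P\sigma+\bar D_1^\top\Pi\bar\sigma+\rho_1-\hat{\mathcal R}_{12}\hat{\mathcal R}_{22}^{-1}\psi,$$ $$\bar\psi:=B_1^\top\bar\eta+D_1^\top P\sigma+\bar D_1^\top\Pi\bar\sigma+\rho_1,\qquad \bar\varphi:=B_2^\top\bar\eta+D_2^\top P\sigma+\bar D_2^\top\Pi\bar\sigma+\rho_2-\hat{\mathcal R}_{12}^\top\hat{\mathcal R}_{11}^{-1}\bar\psi.$$ If solutions $\eta$ and $\bar\eta$ of the first and second equation, respectively, exist in $C([t,T]\times\mathcal S;\mathbb R^n)$, then $\eta=\bar\eta$.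
   Context: $\mathcal S=\{1,\dots,D\}$; $(\lambda_{ij})_{i,j=1}^D$ is a generator matrix with $\lambda_{ij}>0$ for $i\ne j$ and $\sum_j\lambda_{ij}=0$. $\mathbb S^n$: real symmetric $n\times n$ matrices. $M\gg0$ means $M\ge\delta I$ for some constant $\delta>0$ (uniformly in a.e. $s$); $M\ll0$ means $-M\gg0$. Coefficients and standing assumptions (deterministic, each $j\in\mathcal S$): $B=(B_1\ B_2)$, $D=(D_1\ D_2)$, $\bar D=(\bar D_1\ \bar D_2)$, $S=\binom{S_1}{S_2}$, $\rho=\binom{\rho_1}{\rho_2}$, $R=\mathrm{diag}(R_1,R_2)$, $R_\gamma=\mathrm{diag}(R_1,R_2-\gamma^2I)$, blocks $1,2$ having sizes $m,n_v$. $A(\cdot,j)\in L^1(0,T;\mathbb R^{n\times n})$, $B(\cdot,j)\in L^2(0,T;\mathbb R^{n\times(m+n_v)})$, $b(\cdot,j)\in L^1(0,T;\mathbb R^n)$, $C(\cdot,j),\bar C(\cdot,j)\in L^2(0,T;\mathbb R^{n\times n})$, $D(\cdot,j),\bar D(\cdot,j)\in L^\infty(0,T;\mathbb R^{n\times(m+n_v)})$, $\sigma(\cdot,j),\bar\sigma(\cdot,j)\in L^2(0,T;\mathbb R^n)$, $Q(\cdot,j)\in L^1(0,T;\mathbb S^n)$, $S(\cdot,j)\in L^2(0,T;\mathbb R^{(m+n_v)\times n})$, $R(\cdot,j)\in L^\infty(0,T;\mathbb S^{m+n_v})$, $q(\cdot,j)\in L^1(0,T;\mathbb R^n)$, $\rho(\cdot,j)\in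 L^2(0,T;\mathbb R^{m+n_v})$, $G(T,j)\in\mathbb S^n$, $g(T,j)\in\mathbb R^n$; and for a.e. $s$: $G(T,j)\ge0$, $R(s,j)\gg0$, $Q(s,j)-S(s,j)^\top R(s,j)^{-1}S(s,j)\ge0$. Notation (at $(s,i)$): $\bar{\mathcal S}_2=B_2^\top\Pi+D_2^\top\Pi C+\bar D_2^\top\Pi\bar C+S_2$, $\bar{\mathcal R}_2=R_2-\gamma^2I+D_2^\top\Pi D_2+\bar D_2^\top\Pi\bar D_2$, $\hat{\mathcal S}=\binom{\hat{\mathcal S}_1}{\hat{\mathcal S}_2}=B^\top P+D^\top PC+\bar D^\top\Pi\bar C+S$, $\hat{\mathcal R}=\begin{pmatrix}\hat{\mathcal R}_{11}&\hat{\mathcal R}_{12}\\ \hat{\mathcal R}_{12}^\top&\hat{\mathcal R}_{22}\end{pmatrix}=R_\gamma+D^\top PD+\bar D^\top\Pi\bar D$. Coupled Riccati equations ($i\in\mathcal S$, a.e. $s\in[t,T]$): $$\dot\Pi+\Pi A+A^\top\Pi+C^\top\Pi C+\bar C^\top\Pi\bar C-\bar{\mathcal S}_2^\top\bar{\mathcal R}_2^{-1}\bar{\mathcal S}_2+Q+\sum_{j=1}^D\lambda_{ij}\Pi(s,j)=0,\quad \Pi(T,i)=G(T,i),\quad \bar{\mathcal R}_2\ll0,$$ $$\dot P+PA+A^\top P+C^\top PC+\bar C^\top\Pi\bar C-\hat{\mathcal S}^\top\hat{\mathcal R}^{-1}\hat{\mathcal S}+Q+\sum_{j=1}^D\lambda_{ij}P(s,j)=0,\quad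 P(T,i)=G(T,i).$$ *)

theory Defs
  imports "HOL-Analysis.Analysis"
begin

text \<open>Block vectors and matrices; the index type \<open>'m + 'v\<close> has size \<open>m + n\<^sub>v\<close>. Since a matrix is
  a vector of rows, \<open>vcat\<close>, \<open>block1\<close> and \<open>block2\<close> serve both for column vectors and for stacks of
  matrix rows.\<close>

definition vcat :: "'a ^ 'm \<Rightarrow> 'a ^ 'v \<Rightarrow> 'a ^ ('m::finite + 'v::finite)" where
  "vcat x y = (\<chi> k. case k of Inl i \<Rightarrow> x $ i | Inr j \<Rightarrow> y $ j)"

definition hcat :: "'a ^ 'm ^ 'n \<Rightarrow> 'a ^ 'v ^ 'n \<Rightarrow> 'a ^ ('m::finite + 'v::finite) ^ 'n" where
  "hcat M N = (\<chi> k. vcat (M $ k) (N $ k))"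

definition block_diag :: "'a::zero ^ 'm ^ 'm \<Rightarrow> 'a ^ 'v ^ 'v \<Rightarrow> 'a ^ ('m::finite + 'v::finite) ^ ('m::finite + 'v::finite)" where
  "block_diag M N = vcat (hcat M 0) (hcat 0 N)"

definition block1 :: "'a ^ ('m::finite + 'v::finite) \<Rightarrow> 'a ^ 'm" where
  "block1 x = (\<chi> i. x $ Inl i)"

definition block2 :: "'a ^ ('m::finite + 'v::finite) \<Rightarrow> 'a ^ 'v" where
  "block2 x = (\<chi> j. x $ Inr j)"

definition block11 :: "'a ^ ('m::finite + 'v::finite) ^ ('m::finite + 'v::finite) \<Rightarrow> 'a ^ 'm ^ 'm" where
  "block11 M = (\<chi> i j. M $ Inl i $ Inl j)"

definition block12 :: "'a ^ ('m::finite + 'v::finite) ^ ('m::finite + 'v::finite) \<Rightarrow> 'a ^ 'v ^ 'm" where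
  "block12 M = (\<chi> i j. M $ Inl i $ Inr j)"

definition block22 :: "'a ^ ('m::finite + 'v::finite) ^ ('m::finite + 'v::finite) \<Rightarrow> 'a ^ 'v ^ 'v" where
  "block22 M = (\<chi> i j. M $ Inr i $ Inr j)"

definition symmetric :: "real ^ 'n ^ 'n \<Rightarrow> bool" where
  "symmetric M \<longleftrightarrow> transpose M = M"

definition psd :: "real ^ 'n ^ 'n \<Rightarrow> bool" where
  "psd M \<longleftrightarrow> symmetric M \<and> (\<forall>x. 0 \<le> x \<bullet> (M *v x))"

text \<open>The relations \<open>M \<ggreater> 0\<close> and \<open>M \<lless> 0\<close> for functions on \<open>[a, b]\<close>, uniform in almost every
  time.\<close>

definition unif_pos :: "real \<Rightarrow> real \<Rightarrow> (real \<Rightarrow> real ^ 'n ^ 'n) \<Rightarrow> bool" where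
  "unif_pos a b M \<longleftrightarrow> (\<exists>\<delta>>0. AE s in lebesgue_on {a..b}. psd (M s - \<delta> *\<^sub>R mat 1))"

definition unif_neg :: "real \<Rightarrow> real \<Rightarrow> (real \<Rightarrow> real ^ 'n ^ 'n) \<Rightarrow> bool" where
  "unif_neg a b M \<longleftrightarrow> unif_pos a b (\<lambda>s. - M s)"

definition L1 :: "real \<Rightarrow> (real \<Rightarrow> 'a::euclidean_space) \<Rightarrow> bool" where
  "L1 T f \<longleftrightarrow> integrable (lebesgue_on {0..T}) f"

definition L2 :: "real \<Rightarrow> (real \<Rightarrow> 'a::euclidean_space) \<Rightarrow> bool" where
  "L2 T f \<longleftrightarrow> f \<in> borel_measurable (lebesgue_on {0..T}) \<and>
     integrable (lebesgue_on {0..T}) (\<lambda>s. (norm (f s))\<^sup>2)"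

definition Linf :: "real \<Rightarrow> (real \<Rightarrow> 'a::euclidean_space) \<Rightarrow> bool" where
  "Linf T f \<longleftrightarrow> f \<in> borel_measurable (lebesgue_on {0..T}) \<and>
     (\<exists>K. AE s in lebesgue_on {0..T}. norm (f s) \<le> K)"

text \<open>Differential equations with merely integrable coefficients are understood in the sense of
  Caratheodory: a solution is an absolutely continuous function whose derivative exists and
  satisfies the equation almost everywhere. (For a function that is only continuous, the
  equation almost everywhere would not determine the solution.)\<close>

definition abs_cont_on :: "real \<Rightarrow> real \<Rightarrow> (real \<Rightarrow> 'a::real_normed_vector) \<Rightarrow> bool" where
  "abs_cont_on a b f \<longleftrightarrow>
     (\<forall>\<epsilon>>0. \<exists>\<delta>>0. \<forall>(N::nat) (u::nat \<Rightarrow> real) v.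
        (\<forall>k<N. a \<le> u k \<and> u k \<le> v k \<and> v k \<le> b) \<longrightarrow>
        (\<forall>k<N. \<forall>l<N. k \<noteq> l \<longrightarrow> {u k<..<v k} \<inter> {u l<..<v l} = {}) \<longrightarrow>
        (\<Sum>k<N. v k - u k) < \<delta> \<longrightarrow>
        (\<Sum>k<N. norm (f (v k) - f (u k))) < \<epsilon>)"

definition ode_solution ::
    "real \<Rightarrow> real \<Rightarrow> (real \<Rightarrow> 'a \<Rightarrow> 'a) \<Rightarrow> (real \<Rightarrow> 'a::real_normed_vector) \<Rightarrow> bool" where
  "ode_solution a b E y \<longleftrightarrow> abs_cont_on a b y \<and>
     (AE s in lebesgue_on {a..b}.
        \<exists>y'. (y has_vector_derivative y') (at s within {a..b}) \<and> E s y' = 0)"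

text \<open>The coefficients, as functions of time and regime; \<open>b\<close> at the end of a name stands for an
  overbar (except for the drift coefficient \<open>cb\<close> itself). The last two fields are the terminal
  data \<open>G(T, j)\<close> and \<open>g(T, j)\<close>. Below, \<open>PI\<close> is the capital Greek letter Pi, which is a reserved
  binder token.\<close>

record ('n, 'm, 'v, 'k) coeffs =
  cA :: "real \<Rightarrow> 'k \<Rightarrow> real ^ 'n ^ 'n"
  cB1 :: "real \<Rightarrow> 'k \<Rightarrow> real ^ 'm ^ 'n"
  cB2 :: "real \<Rightarrow> 'k \<Rightarrow> real ^ 'v ^ 'n"
  cb :: "real \<Rightarrow> 'k \<Rightarrow> real ^ 'n"
  cC :: "real \<Rightarrow> 'k \<Rightarrow> real ^ 'n ^ 'n"
  cCb :: "real \<Rightarrow> 'k \<Rightarrow> real ^ 'n ^ 'n"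
  cD1 :: "real \<Rightarrow> 'k \<Rightarrow> real ^ 'm ^ 'n"
  cD2 :: "real \<Rightarrow> 'k \<Rightarrow> real ^ 'v ^ 'n"
  cDb1 :: "real \<Rightarrow> 'k \<Rightarrow> real ^ 'm ^ 'n"
  cDb2 :: "real \<Rightarrow> 'k \<Rightarrow> real ^ 'v ^ 'n"
  csigma :: "real \<Rightarrow> 'k \<Rightarrow> real ^ 'n"
  csigmab :: "real \<Rightarrow> 'k \<Rightarrow> real ^ 'n"
  cQ :: "real \<Rightarrow> 'k \<Rightarrow> real ^ 'n ^ 'n"
  cS1 :: "real \<Rightarrow> 'k \<Rightarrow> real ^ 'n ^ 'm"
  cS2 :: "real \<Rightarrow> 'k \<Rightarrow> real ^ 'n ^ 'v"
  cR1 :: "real \<Rightarrow> 'k \<Rightarrow> real ^ 'm ^ 'm"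
  cR2 :: "real \<Rightarrow> 'k \<Rightarrow> real ^ 'v ^ 'v"
  cq :: "real \<Rightarrow> 'k \<Rightarrow> real ^ 'n"
  crho1 :: "real \<Rightarrow> 'k \<Rightarrow> real ^ 'm"
  crho2 :: "real \<Rightarrow> 'k \<Rightarrow> real ^ 'v"
  cG :: "'k \<Rightarrow> real ^ 'n ^ 'n"
  cg :: "'k \<Rightarrow> real ^ 'n"

definition cB :: "('n::finite, 'm::finite, 'v::finite, 'k) coeffs \<Rightarrow> real \<Rightarrow> 'k \<Rightarrow> real ^ ('m::finite + 'v::finite) ^ 'n" where
  "cB c s i = hcat (cB1 c s i) (cB2 c s i)"

definition cD :: "('n::finite, 'm::finite, 'v::finite, 'k) coeffs \<Rightarrow> real \<Rightarrow> 'k \<Rightarrow> real ^ ('m::finite + 'v::finite) ^ 'n" where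
  "cD c s i = hcat (cD1 c s i) (cD2 c s i)"

definition cDb :: "('n::finite, 'm::finite, 'v::finite, 'k) coeffs \<Rightarrow> real \<Rightarrow> 'k \<Rightarrow> real ^ ('m::finite + 'v::finite) ^ 'n" where
  "cDb c s i = hcat (cDb1 c s i) (cDb2 c s i)"

definition cS :: "('n::finite, 'm::finite, 'v::finite, 'k) coeffs \<Rightarrow> real \<Rightarrow> 'k \<Rightarrow> real ^ 'n ^ ('m::finite + 'v::finite)" where
  "cS c s i = vcat (cS1 c s i) (cS2 c s i)"

definition crho :: "('n::finite, 'm::finite, 'v::finite, 'k) coeffs \<Rightarrow> real \<Rightarrow> 'k \<Rightarrow> real ^ ('m::finite + 'v::finite)" where
  "crho c s i = vcat (crho1 c s i) (crho2 c s i)"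

definition cR :: "('n::finite, 'm::finite, 'v::finite, 'k) coeffs \<Rightarrow> real \<Rightarrow> 'k \<Rightarrow> real ^ ('m::finite + 'v::finite) ^ ('m::finite + 'v::finite)" where
  "cR c s i = block_diag (cR1 c s i) (cR2 c s i)"

definition cR_gamma ::
    "('n::finite, 'm::finite, 'v::finite, 'k) coeffs \<Rightarrow> real \<Rightarrow> real \<Rightarrow> 'k \<Rightarrow> real ^ ('m::finite + 'v::finite) ^ ('m::finite + 'v::finite)" where
  "cR_gamma c \<gamma> s i = block_diag (cR1 c s i) (cR2 c s i - \<gamma>\<^sup>2 *\<^sub>R mat 1)"

definition generator :: "('k::finite \<Rightarrow> 'k \<Rightarrow> real) \<Rightarrow> bool" where
  "generator lam \<longleftrightarrow> (\<forall>i j. i \<noteq> j \<longrightarrow> lam i j > 0) \<and> (\<forall>i. (\<Sum>j\<in>UNIV. lam i j) = 0)"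

definition standing_assumptions ::
    "real \<Rightarrow> ('n::finite, 'm::finite, 'v::finite, 'k::finite) coeffs \<Rightarrow> bool" where
  "standing_assumptions T c \<longleftrightarrow>
    (\<forall>j. L1 T (\<lambda>s. cA c s j) \<and> L2 T (\<lambda>s. cB c s j) \<and> L1 T (\<lambda>s. cb c s j) \<and>
         L2 T (\<lambda>s. cC c s j) \<and> L2 T (\<lambda>s. cCb c s j) \<and>
         Linf T (\<lambda>s. cD c s j) \<and> Linf T (\<lambda>s. cDb c s j) \<and>
         L2 T (\<lambda>s. csigma c s j) \<and> L2 T (\<lambda>s. csigmab c s j) \<and>
         L1 T (\<lambda>s. cQ c s j) \<and> L2 T (\<lambda>s. cS c s j) \<and> Linf T (\<lambda>s. cR c s j) \<and>
         (AE s in lebesgue_on {0..T}. symmetric (cQ c s j) \<and> symmetric (cR c s j)) \<and>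
         L1 T (\<lambda>s. cq c s j) \<and> L2 T (\<lambda>s. crho c s j) \<and>
         psd (cG c j) \<and> unif_pos 0 T (\<lambda>s. cR c s j) \<and>
         (AE s in lebesgue_on {0..T}.
            psd (cQ c s j - transpose (cS c s j) ** matrix_inv (cR c s j) ** cS c s j)))"

definition S2_bar ::
    "('n::finite, 'm::finite, 'v::finite, 'k) coeffs \<Rightarrow> (real \<Rightarrow> 'k \<Rightarrow> real ^ 'n ^ 'n) \<Rightarrow>
     real \<Rightarrow> 'k \<Rightarrow> real ^ 'n ^ 'v" where
  "S2_bar c PI s i =
     transpose (cB2 c s i) ** PI s i
     + transpose (cD2 c s i) ** PI s i ** cC c s i
     + transpose (cDb2 c s i) ** PI s i ** cCb c s i + cS2 c s i"

definition R2_bar ::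
    "('n::finite, 'm::finite, 'v::finite, 'k) coeffs \<Rightarrow> real \<Rightarrow> (real \<Rightarrow> 'k \<Rightarrow> real ^ 'n ^ 'n) \<Rightarrow>
     real \<Rightarrow> 'k \<Rightarrow> real ^ 'v ^ 'v" where
  "R2_bar c \<gamma> PI s i =
     cR2 c s i - \<gamma>\<^sup>2 *\<^sub>R mat 1
     + transpose (cD2 c s i) ** PI s i ** cD2 c s i
     + transpose (cDb2 c s i) ** PI s i ** cDb2 c s i"

definition S_hat ::
    "('n::finite, 'm::finite, 'v::finite, 'k) coeffs \<Rightarrow> (real \<Rightarrow> 'k \<Rightarrow> real ^ 'n ^ 'n) \<Rightarrow>
     (real \<Rightarrow> 'k \<Rightarrow> real ^ 'n ^ 'n) \<Rightarrow> real \<Rightarrow> 'k \<Rightarrow> real ^ 'n ^ ('m::finite + 'v::finite)" where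
  "S_hat c PI P s i =
     transpose (cB c s i) ** P s i
     + transpose (cD c s i) ** P s i ** cC c s i
     + transpose (cDb c s i) ** PI s i ** cCb c s i + cS c s i"

definition R_hat ::
    "('n::finite, 'm::finite, 'v::finite, 'k) coeffs \<Rightarrow> real \<Rightarrow> (real \<Rightarrow> 'k \<Rightarrow> real ^ 'n ^ 'n) \<Rightarrow>
     (real \<Rightarrow> 'k \<Rightarrow> real ^ 'n ^ 'n) \<Rightarrow> real \<Rightarrow> 'k \<Rightarrow> real ^ ('m::finite + 'v::finite) ^ ('m::finite + 'v::finite)" where
  "R_hat c \<gamma> PI P s i =
     cR_gamma c \<gamma> s i
     + transpose (cD c s i) ** P s i ** cD c s i
     + transpose (cDb c s i) ** PI s i ** cDb c s i"

text \<open>\<open>C([t, T] \<times> \<S>; \<dots>)\<close>, where the finite regime space carries the discrete topology.\<close>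

definition cont_paths :: "real \<Rightarrow> real \<Rightarrow> (real \<Rightarrow> 'k \<Rightarrow> 'a::topological_space) \<Rightarrow> bool" where
  "cont_paths t T y \<longleftrightarrow> (\<forall>i. continuous_on {t..T} (\<lambda>s. y s i))"

definition riccati_PI ::
    "('n::finite, 'm::finite, 'v::finite, 'k::finite) coeffs \<Rightarrow> ('k \<Rightarrow> 'k \<Rightarrow> real) \<Rightarrow> real \<Rightarrow>
     real \<Rightarrow> real \<Rightarrow> (real \<Rightarrow> 'k \<Rightarrow> real ^ 'n ^ 'n) \<Rightarrow> bool" where
  "riccati_PI c lam \<gamma> t T PI \<longleftrightarrow>
    (\<forall>i. ode_solution t T
           (\<lambda>s PI'. PI' + PI s i ** cA c s i + transpose (cA c s i) ** PI s i
              + transpose (cC c s i) ** PI s i ** cC c s i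
              + transpose (cCb c s i) ** PI s i ** cCb c s i
              - transpose (S2_bar c PI s i) ** matrix_inv (R2_bar c \<gamma> PI s i) ** S2_bar c PI s i
              + cQ c s i + (\<Sum>j\<in>UNIV. lam i j *\<^sub>R PI s j))
           (\<lambda>s. PI s i) \<and>
         PI T i = cG c i \<and>
         unif_neg t T (\<lambda>s. R2_bar c \<gamma> PI s i))"

definition riccati_P ::
    "('n::finite, 'm::finite, 'v::finite, 'k::finite) coeffs \<Rightarrow> ('k \<Rightarrow> 'k \<Rightarrow> real) \<Rightarrow> real \<Rightarrow>
     real \<Rightarrow> real \<Rightarrow> (real \<Rightarrow> 'k \<Rightarrow> real ^ 'n ^ 'n) \<Rightarrow> (real \<Rightarrow> 'k \<Rightarrow> real ^ 'n ^ 'n) \<Rightarrow> bool" where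
  "riccati_P c lam \<gamma> t T PI P \<longleftrightarrow>
    (\<forall>i. ode_solution t T
           (\<lambda>s P'. P' + P s i ** cA c s i + transpose (cA c s i) ** P s i
              + transpose (cC c s i) ** P s i ** cC c s i
              + transpose (cCb c s i) ** PI s i ** cCb c s i
              - transpose (S_hat c PI P s i) ** matrix_inv (R_hat c \<gamma> PI P s i) ** S_hat c PI P s i
              + cQ c s i + (\<Sum>j\<in>UNIV. lam i j *\<^sub>R P s j))
           (\<lambda>s. P s i) \<and>
         P T i = cG c i)"

definition eta_equation ::
    "('n::finite, 'm::finite, 'v::finite, 'k::finite) coeffs \<Rightarrow> ('k \<Rightarrow> 'k \<Rightarrow> real) \<Rightarrow> real \<Rightarrow>
     real \<Rightarrow> real \<Rightarrow> (real \<Rightarrow> 'k \<Rightarrow> real ^ 'n ^ 'n) \<Rightarrow> (real \<Rightarrow> 'k \<Rightarrow> real ^ 'n ^ 'n) \<Rightarrow>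
     (real \<Rightarrow> 'k \<Rightarrow> real ^ 'n) \<Rightarrow> bool" where
  "eta_equation c lam \<gamma> t T PI P \<eta> \<longleftrightarrow>
    (\<forall>i. ode_solution t T
           (\<lambda>s \<eta>'.
              let S1 = block1 (S_hat c PI P s i);
                  S2 = block2 (S_hat c PI P s i);
                  R11 = block11 (R_hat c \<gamma> PI P s i);
                  R12 = block12 (R_hat c \<gamma> PI P s i);
                  R22 = block22 (R_hat c \<gamma> PI P s i);
                  \<psi> = transpose (cB2 c s i) *v \<eta> s i
                      + transpose (cD2 c s i) *v (P s i *v csigma c s i)
                      + transpose (cDb2 c s i) *v (PI s i *v csigmab c s i) + crho2 c s i;
                  \<phi> = transpose (cB1 c s i) *v \<eta> s i
                      + transpose (cD1 c s i) *v (P s i *v csigma c s i)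
                      + transpose (cDb1 c s i) *v (PI s i *v csigmab c s i) + crho1 c s i
                      - R12 *v (matrix_inv R22 *v \<psi>)
              in \<eta>' + transpose (cA c s i) *v \<eta> s i
                 - transpose S2 *v (matrix_inv R22 *v \<psi>)
                 - transpose (S1 - R12 ** matrix_inv R22 ** S2)
                     *v (matrix_inv (R11 - R12 ** matrix_inv R22 ** transpose R12) *v \<phi>)
                 + transpose (cC c s i) *v (P s i *v csigma c s i)
                 + transpose (cCb c s i) *v (PI s i *v csigmab c s i)
                 + P s i *v cb c s i + cq c s i + (\<Sum>j\<in>UNIV. lam i j *\<^sub>R \<eta> s j))
           (\<lambda>s. \<eta> s i) \<and>
         \<eta> T i = cg c i)"

definition eta_bar_equation ::
    "('n::finite, 'm::finite, 'v::finite, 'k::finite) coeffs \<Rightarrow> ('k \<Rightarrow> 'k \<Rightarrow> real) \<Rightarrow> real \<Rightarrow>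
     real \<Rightarrow> real \<Rightarrow> (real \<Rightarrow> 'k \<Rightarrow> real ^ 'n ^ 'n) \<Rightarrow> (real \<Rightarrow> 'k \<Rightarrow> real ^ 'n ^ 'n) \<Rightarrow>
     (real \<Rightarrow> 'k \<Rightarrow> real ^ 'n) \<Rightarrow> bool" where
  "eta_bar_equation c lam \<gamma> t T PI P \<eta> \<longleftrightarrow>
    (\<forall>i. ode_solution t T
           (\<lambda>s \<eta>'.
              let S1 = block1 (S_hat c PI P s i);
                  S2 = block2 (S_hat c PI P s i);
                  R11 = block11 (R_hat c \<gamma> PI P s i);
                  R12 = block12 (R_hat c \<gamma> PI P s i);
                  R22 = block22 (R_hat c \<gamma> PI P s i);
                  \<psi> = transpose (cB1 c s i) *v \<eta> s i
                      + transpose (cD1 c s i) *v (P s i *v csigma c s i)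
                      + transpose (cDb1 c s i) *v (PI s i *v csigmab c s i) + crho1 c s i;
                  \<phi> = transpose (cB2 c s i) *v \<eta> s i
                      + transpose (cD2 c s i) *v (P s i *v csigma c s i)
                      + transpose (cDb2 c s i) *v (PI s i *v csigmab c s i) + crho2 c s i
                      - transpose R12 *v (matrix_inv R11 *v \<psi>)
              in \<eta>' + transpose (cA c s i) *v \<eta> s i
                 - transpose S1 *v (matrix_inv R11 *v \<psi>)
                 - transpose (S2 - transpose R12 ** matrix_inv R11 ** S1)
                     *v (matrix_inv (R22 - transpose R12 ** matrix_inv R11 ** R12) *v \<phi>)
                 + transpose (cC c s i) *v (P s i *v csigma c s i)
                 + transpose (cCb c s i) *v (PI s i *v csigmab c s i)
                 + P s i *v cb c s i + cq c s i + (\<Sum>j\<in>UNIV. lam i j *\<^sub>R \<eta> s j))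
           (\<lambda>s. \<eta> s i) \<and>
         \<eta> T i = cg c i)"

end

theory Submission
  imports Defs
begin

text \<open>Set \<open>\<theta>(\<eta>) = B\<^sup>T \<eta> + D\<^sup>T P \<sigma> + Db\<^sup>T \<Pi> \<sigma>b + \<rho>\<close>. Eliminating either
  block of unknowns from \<open>R u = \<theta>(\<eta>)\<close>, with \<open>R\<close> the matrix \<open>R_hat\<close>, shows that both feedback
  terms equal \<open>S\<^sup>T R\<^sup>-\<^sup>1 \<theta>(\<eta>)\<close>, so both functions solve the same linear equation. Since \<open>R\<close>
  has a uniformly positive first and a uniformly negative second diagonal block, \<open>R\<^sup>-\<^sup>1\<close> is
  bounded; as \<open>B\<close> and \<open>S\<close> are square integrable, the difference of the solutions satisfies a linear
  differential inequality with integrable coefficient and vanishes at \<open>T\<close>, hence it vanishes.\<close>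

section \<open>Absolute continuity and the fundamental theorem of calculus\<close>

text \<open>\<open>abs_cont_on\<close> speaks of families indexed by an initial segment of the
  naturals, whereas Riemann sums run over finite sets of tagged intervals. A bijective enumeration
  carries the estimate over with the same \<delta>.\<close>

lemma abs_cont_on_finite_family:
  assumes "abs_cont_on a b f" and "\<epsilon> > 0"
  obtains \<delta> where "\<delta> > 0"
    and "\<And>I u v. \<lbrakk>finite I; \<And>k. k \<in> I \<Longrightarrow> a \<le> u k \<and> u k \<le> v k \<and> v k \<le> b;
          disjoint_family_on (\<lambda>k. {u k<..<v k}) I; (\<Sum>k\<in>I. v k - u k) < \<delta>\<rbrakk>
        \<Longrightarrow> (\<Sum>k\<in>I. norm (f (v k) - f (u k))) < \<epsilon>"
proof -
  obtain \<delta> where "\<delta> > 0" and \<delta>: "\<forall>(N::nat) (u::nat \<Rightarrow> real) v.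
        (\<forall>k<N. a \<le> u k \<and> u k \<le> v k \<and> v k \<le> b) \<longrightarrow>
        (\<forall>k<N. \<forall>l<N. k \<noteq> l \<longrightarrow> {u k<..<v k} \<inter> {u l<..<v l} = {}) \<longrightarrow>
        (\<Sum>k<N. v k - u k) < \<delta> \<longrightarrow>
        (\<Sum>k<N. norm (f (v k) - f (u k))) < \<epsilon>"
    using assms(1)[unfolded abs_cont_on_def, rule_format, OF assms(2)] by (elim exE conjE) (rule that)
  show ?thesis
  proof
    show "\<delta> > 0" by fact
  next
    fix I :: "'b set" and u v
    assume I: "finite I" "\<And>k. k \<in> I \<Longrightarrow> a \<le> u k \<and> u k \<le> v k \<and> v k \<le> b"
      "disjoint_family_on (\<lambda>k. {u k<..<v k}) I" "(\<Sum>k\<in>I. v k - u k) < \<delta>"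
    obtain h where h: "bij_betw h {..<card I} I"
      using ex_bij_betw_nat_finite[OF \<open>finite I\<close>] by (auto simp: atLeast0LessThan)
    have hI: "h k \<in> I" if "k < card I" for k
      using h that by (auto simp: bij_betw_def)
    have dis: "{u (h k)<..<v (h k)} \<inter> {u (h l)<..<v (h l)} = {}"
      if "k < card I" "l < card I" "k \<noteq> l" for k l
    proof -
      have "h k \<noteq> h l" using h that by (auto simp: bij_betw_def inj_on_def)
      then show ?thesis using I(3) hI that by (auto simp: disjoint_family_on_def)
    qed
    have "(\<Sum>k<card I. norm (f (v (h k)) - f (u (h k)))) < \<epsilon>"
    proof (rule \<delta>[rule_format])
      show "(\<Sum>k<card I. v (h k) - u (h k)) < \<delta>"
        using I(4) by (simp add: sum.reindex_bij_betw[OF h, of "\<lambda>k. v k - u k"])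
    qed (use I(2) hI dis in auto)
    then show "(\<Sum>k\<in>I. norm (f (v k) - f (u k))) < \<epsilon>"
      by (simp add: sum.reindex_bij_betw[OF h, of "\<lambda>k. norm (f (v k) - f (u k))"])
  qed
qed

lemma abs_cont_on_subinterval:
  assumes "abs_cont_on a b f" "a \<le> c" "d \<le> b"
  shows "abs_cont_on c d f"
  unfolding abs_cont_on_def
proof (intro allI impI)
  fix \<epsilon> :: real assume "\<epsilon> > 0"
  obtain \<delta> where "\<delta> > 0" and \<delta>: "\<forall>(N::nat) (u::nat \<Rightarrow> real) v.
        (\<forall>k<N. a \<le> u k \<and> u k \<le> v k \<and> v k \<le> b) \<longrightarrow>
        (\<forall>k<N. \<forall>l<N. k \<noteq> l \<longrightarrow> {u k<..<v k} \<inter> {u l<..<v l} = {}) \<longrightarrow>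
        (\<Sum>k<N. v k - u k) < \<delta> \<longrightarrow>
        (\<Sum>k<N. norm (f (v k) - f (u k))) < \<epsilon>"
    using assms(1)[unfolded abs_cont_on_def, rule_format, OF \<open>\<epsilon> > 0\<close>] by (elim exE conjE) (rule that)
  show "\<exists>\<delta>>0. \<forall>(N::nat) (u::nat \<Rightarrow> real) v.
        (\<forall>k<N. c \<le> u k \<and> u k \<le> v k \<and> v k \<le> d) \<longrightarrow>
        (\<forall>k<N. \<forall>l<N. k \<noteq> l \<longrightarrow> {u k<..<v k} \<inter> {u l<..<v l} = {}) \<longrightarrow>
        (\<Sum>k<N. v k - u k) < \<delta> \<longrightarrow>
        (\<Sum>k<N. norm (f (v k) - f (u k))) < \<epsilon>"
  proof (intro exI[of _ \<delta>] conjI allI impI)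
    fix N :: nat and u v :: "nat \<Rightarrow> real"
    assume *: "\<forall>k<N. c \<le> u k \<and> u k \<le> v k \<and> v k \<le> d"
      "\<forall>k<N. \<forall>l<N. k \<noteq> l \<longrightarrow> {u k<..<v k} \<inter> {u l<..<v l} = {}" "(\<Sum>k<N. v k - u k) < \<delta>"
    have "\<forall>k<N. a \<le> u k \<and> u k \<le> v k \<and> v k \<le> b"
      using *(1) assms(2,3) order_trans by blast
    with * show "(\<Sum>k<N. norm (f (v k) - f (u k))) < \<epsilon>" by (intro \<delta>[THEN spec, THEN spec, THEN spec, THEN mp, THEN mp, THEN mp])
  qed (fact \<open>\<delta> > 0\<close>)
qed

text \<open>Passing from an interval to its interior costs no length, and the interiors in a partial
  division are disjoint, so their lengths add up inside \<open>U\<close>.\<close>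

lemma sum_content_le_measure:
  fixes p :: "(real \<times> real set) set"
  assumes p: "p tagged_partial_division_of S" and sub: "\<And>x K. (x, K) \<in> p \<Longrightarrow> K \<subseteq> U"
    and U: "U \<in> lmeasurable"
  shows "(\<Sum>(x, K)\<in>p. measure lborel K) \<le> measure lebesgue U"
proof -
  have fin: "finite p" using tagged_partial_division_ofD(1)[OF p] .
  have int: "measure lborel K = measure lebesgue (interior K) \<and> interior K \<in> lmeasurable"
    if xK: "(x, K) \<in> p" for x K
  proof -
    obtain u v where K: "K = cbox u v" using tagged_partial_division_ofD(4)[OF p xK] by blast
    have "interior K = box u v" using K interior_cbox by blast
    then show ?thesis using K by (simp add: measure_lborel_box_eq measure_lborel_cbox_eq)
  qed
  have dis: "disjoint_family_on (\<lambda>(x, K). interior K) p"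
    using tagged_partial_division_ofD(5)[OF p] by (fastforce simp: disjoint_family_on_def)
  have "(\<Sum>(x, K)\<in>p. measure lborel K) = (\<Sum>(x, K)\<in>p. measure lebesgue (interior K))"
    using int by (intro sum.cong) auto
  also have "\<dots> = measure lebesgue (\<Union>(x, K)\<in>p. interior K)"
  proof -
    have "(\<lambda>(x, K). interior K) ` p \<subseteq> sets lebesgue"
      using int by (auto simp: fmeasurableD)
    moreover have "\<And>i. i \<in> p \<Longrightarrow> emeasure lebesgue ((\<lambda>(x, K). interior K) i) \<noteq> \<infinity>"
      using int by (auto simp: fmeasurable_def less_top)
    ultimately show ?thesis
      using measure_finite_Union[OF fin _ dis, of lebesgue] by (simp add: case_prod_beta')
  qed
  also have "\<dots> \<le> measure lebesgue U"
  proof (rule measure_mono_fmeasurable[OF _ _ U])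
    show "(\<Union>(x, K)\<in>p. interior K) \<subseteq> U" using sub interior_subset by blast
    show "(\<Union>(x, K)\<in>p. interior K) \<in> sets lebesgue"
      using int by (intro sets.finite_UN fin) (auto simp: fmeasurableD)
  qed
  finally show ?thesis .
qed

text \<open>Outer regularity: some open superset exceeds \<open>N\<close> by less than \<delta>, and
  removing the null set \<open>N\<close> does not change its measure.\<close>

lemma null_set_outer_open:
  fixes N :: "real set"
  assumes "negligible N" "\<delta> > 0"
  obtains U where "open U" "N \<subseteq> U" "U \<in> lmeasurable" "measure lebesgue U < \<delta>"
proof -
  have N: "N \<in> null_sets lebesgue" using assms by (simp add: negligible_iff_null_sets)
  obtain U where U: "open U" "N \<subseteq> U" "U - N \<in> lmeasurable" "emeasure lebesgue (U - N) < ennreal \<delta>"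
    using sets_lebesgue_outer_open[of N \<delta>] N assms(2) by blast
  have "emeasure lebesgue U < ennreal \<delta>"
    using U(1,4) N by (simp add: emeasure_Diff_null_set)
  moreover from this U(1) have lm: "U \<in> lmeasurable"
    by (auto simp: fmeasurable_def less_top intro: order.strict_trans)
  ultimately have "measure lebesgue U < \<delta>"
    using assms(2) by (simp only: emeasure_eq_measure2 ennreal_less_iff measure_nonneg)
  with U lm that show ?thesis by blast
qed

text \<open>Henstock's gauge: at exceptional points it confines the tagged intervals to an open set so
  small that absolute continuity controls their contribution.\<close>

theorem fundamental_theorem_of_calculus_abs_cont:
  fixes f :: "real \<Rightarrow> 'a::banach"
  assumes "a \<le> b" and ac: "abs_cont_on a b f" and N: "negligible N"
    and deriv: "\<And>x. x \<in> {a..b} - N \<Longrightarrow> (f has_vector_derivative f' x) (at x within {a..b})"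
  shows "(f' has_integral (f b - f a)) {a..b}"
proof (rule has_integral_spike[OF N])
  \<comment> \<open>The integral ignores values on the null set \<open>N\<close>. With 0 there, a
    tag in \<open>N\<close> contributes nothing to a Riemann sum, whatever \<open>f'\<close> is at
    that point.\<close>
  define g where "g x = (if x \<in> N then 0 else f' x)" for x
  show "\<And>x. x \<in> {a..b} - N \<Longrightarrow> f' x = g x" by (simp add: g_def)
  have "(g has_integral (f b - f a)) (cbox a b)"
    unfolding has_integral
  proof (intro allI impI)
    fix e :: real assume "e > 0"
    \<comment> \<open>The errors at differentiability points will total at most
      \<open>e' * (b - a)\<close>; the summand 1 keeps the denominator positive when
      \<open>a = b\<close> and the comparison with \<open>e / 2\<close> strict.\<close>
    define e' where "e' = e / (2 * (b - a + 1))"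
    have e': "e' > 0" "e' * (b - a) < e / 2"
      using \<open>e > 0\<close> \<open>a \<le> b\<close> by (auto simp: e'_def field_simps)
    obtain \<delta> where "\<delta> > 0" and \<delta>: "\<And>(I::(real \<times> real set) set) u v. \<lbrakk>finite I;
          \<And>k. k \<in> I \<Longrightarrow> a \<le> u k \<and> u k \<le> v k \<and> v k \<le> b;
          disjoint_family_on (\<lambda>k. {u k<..<v k}) I; (\<Sum>k\<in>I. v k - u k) < \<delta>\<rbrakk>
        \<Longrightarrow> (\<Sum>k\<in>I. norm (f (v k) - f (u k))) < e / 2"
      by (rule abs_cont_on_finite_family[OF ac half_gt_zero[OF \<open>e > 0\<close>]]) blast
    obtain U where U: "open U" "N \<subseteq> U" "U \<in> lmeasurable" "measure lebesgue U < \<delta>"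
      using null_set_outer_open[OF N \<open>\<delta> > 0\<close>] by blast
    \<comment> \<open>Differentiability gives a radius of linear approximation with relative error
      \<open>e'\<close>; outside \<open>{a..b} - N\<close> the condition is vacuous and any positive
      radius serves, so \<open>d\<close> is total.\<close>
    have "\<exists>d>0. x \<in> {a..b} - N \<longrightarrow>
       (\<forall>y\<in>{a..b}. norm (y-x) < d \<longrightarrow> norm (f y - f x - (y-x) *\<^sub>R f' x) \<le> e' * norm (y-x))" for x
    proof (cases "x \<in> {a..b} - N")
      case True
      then show ?thesis
        using deriv[OF True, unfolded has_vector_derivative_def has_derivative_within_alt] e'(1) by blast
    qed (auto intro: zero_less_one)
    then obtain d where d: "\<And>x. 0 < d x"
       "\<And>x y. \<lbrakk>x \<in> {a..b} - N; y \<in> {a..b}; norm (y-x) < d x\<rbrakk>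
          \<Longrightarrow> norm (f y - f x - (y-x) *\<^sub>R f' x) \<le> e' * norm (y-x)"
      by metis
    define \<G> where "\<G> x = (if x \<in> N then U else ball x (d x))" for x
    have "gauge \<G>" unfolding gauge_def \<G>_def using U d(1) by auto
    moreover have "norm ((\<Sum>(x, K)\<in>p. measure lborel K *\<^sub>R g x) - (f b - f a)) < e"
      if p: "p tagged_division_of cbox a b" and fine: "\<G> fine p" for p
    proof -
      \<comment> \<open>The increments of \<open>f\<close> over the division telescope to
        \<open>f b - f a\<close>; \<open>r\<close> collects the intervals tagged in
        \<open>N\<close>.\<close>
      define \<Delta> where "\<Delta> = (\<lambda>(x::real, K). f (Sup K) - f (Inf K))"
      define r where "r = p \<inter> (N \<times> UNIV)"
      have fin: "finite p" using tagged_division_ofD(1)[OF p] .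
      have K: "\<exists>u v. K = {u..v} \<and> u \<le> v \<and> a \<le> u \<and> v \<le> b \<and> x \<in> K" if xK: "(x, K) \<in> p" for x K
      proof -
        obtain u v where "K = cbox u v" "x \<in> K" "K \<subseteq> cbox a b"
          using tagged_division_ofD(2-4)[OF p xK] by blast
        then show ?thesis by (intro exI[of _ u] exI[of _ v]) auto
      qed
      have ba: "b - a = (\<Sum>(x, K)\<in>p. measure lborel K)"
        using additive_content_tagged_division[OF p] \<open>a \<le> b\<close> by simp
      have fba: "f b - f a = (\<Sum>k\<in>p. \<Delta> k)"
        using additive_tagged_division_1[where f = f] \<open>a \<le> b\<close> p by (auto simp: \<Delta>_def)
      \<comment> \<open>The tag \<open>x\<close> lies between the endpoints, so the approximation
        errors at \<open>u\<close> and \<open>v\<close>, at most \<open>e'\<close> times the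
        distances to \<open>x\<close>, add up to at most \<open>e'\<close> times the length.\<close>
      have good: "norm (measure lborel (snd k) *\<^sub>R g (fst k) - \<Delta> k) \<le> e' * measure lborel (snd k)" if "k \<in> p - r" for k
      proof -
        obtain x K0 where k: "k = (x, K0)" by (cases k)
        with that have xK: "(x, K0) \<in> p" "x \<notin> N" by (auto simp: r_def)
        then obtain u v where uv: "K0 = {u..v}" "u \<le> v" "a \<le> u" "v \<le> b" "x \<in> K0" using K by metis
        have "K0 \<subseteq> ball x (d x)" using fineD[OF fine xK(1)] xK(2) by (simp add: \<G>_def)
        then have *: "norm (y - x) < d x" if "y \<in> {u,v}" for y
        proof -
          have "y \<in> ball x (d x)" using that uv \<open>K0 \<subseteq> _\<close> by (auto simp del: mem_ball)
          then show ?thesis by (simp add: dist_norm norm_minus_commute)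
        qed
        have "norm ((v - u) *\<^sub>R f' x - (f v - f u)) = norm (f u - f x - (u - x) *\<^sub>R f' x - (f v - f x - (v - x) *\<^sub>R f' x))"
          by (auto simp: algebra_simps)
        also have "\<dots> \<le> norm (f u - f x - (u - x) *\<^sub>R f' x) + norm (f v - f x - (v - x) *\<^sub>R f' x)"
          by (rule norm_triangle_ineq4)
        also have "\<dots> \<le> e' * norm (u - x) + e' * norm (v - x)"
          using uv xK by (intro add_mono d(2) *) auto
        also have "\<dots> = e' * (v - u)" using uv by (simp add: algebra_simps)
        finally show ?thesis using uv xK by (simp add: k \<Delta>_def g_def)
      qed
      \<comment> \<open>By fineness, intervals tagged in \<open>N\<close> lie in \<open>U\<close>,
        so their total length is below \<delta> and absolute continuity bounds the sum of their
        increments.\<close>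
      have bad: "(\<Sum>k\<in>r. norm (\<Delta> k)) < e / 2"
      proof -
        have pr: "r tagged_partial_division_of cbox a b"
          by (rule tagged_partial_division_subset[of p])
            (use p in \<open>auto simp: r_def tagged_division_of_def\<close>)
        have "(\<Sum>k\<in>r. norm (f (Sup (snd k)) - f (Inf (snd k)))) < e / 2"
        proof (rule \<delta>)
          show "finite r" using fin by (simp add: r_def)
          show "a \<le> Inf (snd k) \<and> Inf (snd k) \<le> Sup (snd k) \<and> Sup (snd k) \<le> b" if "k \<in> r" for k
            using K[of "fst k" "snd k"] that by (cases k) (auto simp: r_def)
          have int: "{Inf (snd k)<..<Sup (snd k)} = interior (snd k)" if "k \<in> r" for k
            using K[of "fst k" "snd k"] that by (cases k) (auto simp: r_def)
          show "disjoint_family_on (\<lambda>k. {Inf (snd k)<..<Sup (snd k)}) r"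
            unfolding disjoint_family_on_def
          proof (intro ballI impI)
            fix k l assume "k \<in> r" "l \<in> r" "k \<noteq> l"
            then show "{Inf (snd k)<..<Sup (snd k)} \<inter> {Inf (snd l)<..<Sup (snd l)} = {}"
              using tagged_partial_division_ofD(5)[OF pr, of "fst k" "snd k" "fst l" "snd l"] int by simp
          qed
          have "(\<Sum>k\<in>r. Sup (snd k) - Inf (snd k)) = (\<Sum>(x, K)\<in>r. measure lborel K)"
          proof (rule sum.cong[OF refl], clarify)
            fix x K0 assume "(x, K0) \<in> r"
            then show "Sup (snd (x, K0)) - Inf (snd (x, K0)) = measure lborel K0" using K[of x K0] by (auto simp: r_def)
          qed
          also have "\<dots> \<le> measure lebesgue U"
          proof (rule sum_content_le_measure[OF pr _ U(3)])
            show "K \<subseteq> U" if "(x, K) \<in> r" for x K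
              using fineD[OF fine, of x K] that by (simp add: \<G>_def r_def)
          qed
          finally show "(\<Sum>k\<in>r. Sup (snd k) - Inf (snd k)) < \<delta>" using U by simp
        qed
        then show ?thesis by (simp add: \<Delta>_def case_prod_beta)
      qed
      have "(\<Sum>(x, K)\<in>p. measure lborel K *\<^sub>R g x) - (f b - f a) = (\<Sum>k\<in>p. measure lborel (snd k) *\<^sub>R g (fst k) - \<Delta> k)"
        by (simp add: fba sum_subtractf case_prod_beta)
      also have "\<dots> = (\<Sum>k\<in>p-r. measure lborel (snd k) *\<^sub>R g (fst k) - \<Delta> k) + (\<Sum>k\<in>r. measure lborel (snd k) *\<^sub>R g (fst k) - \<Delta> k)"
        using fin by (intro sum.subset_diff) (auto simp: r_def)
      \<comment> \<open>On \<open>r\<close> the integrand \<open>g\<close> is 0, so only the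
        increments remain.\<close>
      also have "(\<Sum>k\<in>r. measure lborel (snd k) *\<^sub>R g (fst k) - \<Delta> k) = (\<Sum>k\<in>r. - \<Delta> k)"
        by (intro sum.cong) (auto simp: r_def g_def)
      finally have "norm ((\<Sum>(x, K)\<in>p. measure lborel K *\<^sub>R g x) - (f b - f a))
        \<le> norm (\<Sum>k\<in>p-r. measure lborel (snd k) *\<^sub>R g (fst k) - \<Delta> k) + norm (\<Sum>k\<in>r. - \<Delta> k)"
        by (simp only: norm_triangle_ineq)
      also have "\<dots> \<le> (\<Sum>k\<in>p-r. e' * measure lborel (snd k)) + (\<Sum>k\<in>r. norm (\<Delta> k))"
        by (intro add_mono sum_norm_le good) auto
      also have "(\<Sum>k\<in>p-r. e' * measure lborel (snd k)) \<le> (\<Sum>k\<in>p. e' * measure lborel (snd k))"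
        using fin e'(1) by (intro sum_mono2) auto
      also have "\<dots> = e' * (b - a)" by (simp add: ba sum_distrib_left case_prod_beta)
      finally show ?thesis using bad e'(2) by simp
    qed
    ultimately show "\<exists>\<gamma>. gauge \<gamma> \<and> (\<forall>\<D>. \<D> tagged_division_of cbox a b \<and> \<gamma> fine \<D> \<longrightarrow>
        norm ((\<Sum>(x, K)\<in>\<D>. measure lborel K *\<^sub>R g x) - (f b - f a)) < e)"
      by (intro exI[of _ \<G>] conjI allI impI) auto
  qed
  then show "(g has_integral (f b - f a)) {a..b}" by simp
qed

section \<open>Uniqueness for backward equations with integrable coefficients\<close>

lemma AE_lebesgue_on_negligible:
  fixes a b :: real
  assumes "AE s in lebesgue_on {a..b}. P s"
  obtains N where "negligible N" "\<And>s. s \<in> {a..b} - N \<Longrightarrow> P s"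
proof -
  have "AE s in lebesgue. s \<in> {a..b} \<longrightarrow> P s"
    using assms by (subst (asm) AE_restrict_space_iff) auto
  then obtain N where "N \<in> null_sets lebesgue" "{s \<in> space lebesgue. \<not> (s \<in> {a..b} \<longrightarrow> P s)} \<subseteq> N"
    by (auto simp: eventually_ae_filter)
  then show ?thesis using that[of N] by (auto simp: negligible_iff_null_sets)
qed

lemma AE_lebesgue_on_subset:
  fixes a b c d :: real
  assumes "AE s in lebesgue_on {c..d}. P s" "{a..b} \<subseteq> {c..d}"
  shows "AE s in lebesgue_on {a..b}. P s"
proof -
  have "AE s in lebesgue. s \<in> {c..d} \<longrightarrow> P s" using assms(1) by (subst (asm) AE_restrict_space_iff) auto
  then have "AE s in lebesgue. s \<in> {a..b} \<longrightarrow> P s" by eventually_elim (use assms(2) in blast)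
  then show ?thesis by (subst AE_restrict_space_iff) auto
qed

text \<open>The integral form of Gronwall's argument: on an interval where the integral of \<open>L\<close> is below
  \<open>1 / 2\<close>, the maximum of \<open>\<Phi>\<close> is at most half of itself.\<close>

lemma backward_vanishing:
  fixes \<Phi> L :: "real \<Rightarrow> real"
  assumes cont: "continuous_on {a..b} \<Phi>" and nonneg: "\<And>s. s \<in> {a..b} \<Longrightarrow> 0 \<le> \<Phi> s"
    and L: "L integrable_on {a..b}" and "\<Phi> b = 0"
    and step: "\<And>s \<tau> M. \<lbrakk>a \<le> s; s \<le> \<tau>; \<tau> \<le> b; \<Phi> \<tau> = 0; \<And>r. r \<in> {s..\<tau>} \<Longrightarrow> \<Phi> r \<le> M\<rbrakk>
               \<Longrightarrow> \<Phi> s \<le> M * integral {s..\<tau>} L"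
    and "s \<in> {a..b}"
  shows "\<Phi> s = 0"
proof -
  \<comment> \<open>Uniform continuity of the indefinite integral yields one length \<open>h\<close>
    such that the integral of \<open>L\<close> over any shorter subinterval stays under 1 /
    2.\<close>
  have "uniformly_continuous_on {a..b} (\<lambda>x. integral {a..x} L)"
    by (intro compact_uniformly_continuous indefinite_integral_continuous_1 L) simp
  then obtain h where "h > 0" and h: "\<And>x y. \<lbrakk>x \<in> {a..b}; y \<in> {a..b}; \<bar>y - x\<bar> < h\<rbrakk>
      \<Longrightarrow> \<bar>integral {a..y} L - integral {a..x} L\<bar> < 1 / 2"
    unfolding uniformly_continuous_on_def dist_real_def
    by (drule_tac x = "1 / 2" in spec) auto
  \<comment> \<open>The zero of \<Phi> at \<open>b\<close> is propagated backwards in strides of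
    \<open>h / 2\<close>; the half leaves the strict inequality \<open>\<tau> < s + h\<close> that
    the choice of \<open>h\<close> asks for.\<close>
  have *: "\<forall>s\<in>{a..b}. b - s \<le> n * (h / 2) \<longrightarrow> \<Phi> s = 0" for n :: nat
  proof (induction n)
    case 0
    then show ?case using \<open>\<Phi> b = 0\<close> by (auto simp: antisym)
  next
    case (Suc n)
    show ?case
    proof (intro ballI impI)
      fix s assume s: "s \<in> {a..b}" "b - s \<le> Suc n * (h / 2)"
      define \<tau> where "\<tau> = min b (s + h / 2)"
      have \<tau>: "s \<le> \<tau>" "\<tau> \<le> b" "\<tau> < s + h" using s \<open>h > 0\<close> by (auto simp: \<tau>_def)
      have "\<tau> \<in> {a..b}" using \<tau> s by auto
      moreover have "b - \<tau> \<le> n * (h / 2)"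
        using s \<open>h > 0\<close> by (auto simp: \<tau>_def min_def field_simps)
      ultimately have \<tau>0: "\<Phi> \<tau> = 0" using Suc.IH by blast
      have "continuous_on {s..\<tau>} \<Phi>" using cont by (rule continuous_on_subset) (use s \<tau> in auto)
      then obtain r where r: "r \<in> {s..\<tau>}" "\<And>x. x \<in> {s..\<tau>} \<Longrightarrow> \<Phi> x \<le> \<Phi> r"
        using continuous_attains_sup[of "{s..\<tau>}" \<Phi>] \<tau> by auto
      \<comment> \<open>The estimate is applied at the maximum point \<open>r\<close> rather than at
        \<open>s\<close>: there \<open>M\<close> can be \<open>\<Phi> r\<close> itself, and
        \<open>\<Phi> r \<le> \<Phi> r / 2\<close> forces \<open>\<Phi> r = 0\<close>.\<close>
      have "\<Phi> r \<le> \<Phi> r * integral {r..\<tau>} L"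
        using r s \<tau> \<tau>0 by (intro step) auto
      moreover have "integral {a..r} L + integral {r..\<tau>} L = integral {a..\<tau>} L"
        using r s \<tau> by (intro Henstock_Kurzweil_Integration.integral_combine integrable_subinterval_real[OF L]) auto
      then have "integral {r..\<tau>} L < 1 / 2" using h[of r \<tau>] r s \<tau> unfolding abs_less_iff by auto
      moreover have "0 \<le> \<Phi> r" using nonneg r s \<tau> by auto
      ultimately have "\<Phi> r = 0"
        using mult_left_mono[of "integral {r..\<tau>} L" "1 / 2" "\<Phi> r"] by linarith
      then show "\<Phi> s = 0" using r(2)[of s] nonneg[of s] s \<tau> by force
    qed
  qed
  obtain n :: nat where "(b - a) / (h / 2) \<le> n" using real_arch_simple by blast
  then have "b - s \<le> n * (h / 2)" using \<open>s \<in> {a..b}\<close> \<open>h > 0\<close> by (simp add: field_simps)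
  then show ?thesis using * \<open>s \<in> {a..b}\<close> by blast
qed

text \<open>The derivative bound in one regime involves the differences in all regimes, so the
  quantity to follow is their sum \<Phi>. Integrating from \<open>s\<close> to a zero \<tau> of
  \<Phi> and summing over the regimes gives the hypothesis \<open>step\<close> of
  \<open>backward_vanishing\<close>.\<close>

lemma backward_ode_unique:
  fixes y z :: "real \<Rightarrow> 'k::finite \<Rightarrow> 'a::banach" and L :: "'k \<Rightarrow> real \<Rightarrow> real"
  assumes ac: "\<And>i. abs_cont_on a b (\<lambda>s. y s i)" "\<And>i. abs_cont_on a b (\<lambda>s. z s i)"
    and cont: "cont_paths a b y" "cont_paths a b z"
    and L: "\<And>i. L i integrable_on {a..b}" "\<And>i s. s \<in> {a..b} \<Longrightarrow> 0 \<le> L i s"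
    and deriv: "\<And>i. AE s in lebesgue_on {a..b}. \<exists>y' z'.
        ((\<lambda>s. y s i) has_vector_derivative y') (at s within {a..b}) \<and>
        ((\<lambda>s. z s i) has_vector_derivative z') (at s within {a..b}) \<and>
        norm (y' - z') \<le> L i s * (\<Sum>j\<in>UNIV. norm (y s j - z s j))"
    and terminal: "\<And>i. y b i = z b i"
    and "s \<in> {a..b}"
  shows "y s i = z s i"
proof -
  define \<Phi> where "\<Phi> s = (\<Sum>j\<in>UNIV. norm (y s j - z s j))" for s
  have "\<Phi> s = 0"
  proof (rule backward_vanishing[of a b \<Phi> "\<lambda>s. \<Sum>i\<in>UNIV. L i s"])
    show "continuous_on {a..b} \<Phi>"
      unfolding \<Phi>_def using cont by (auto simp: cont_paths_def intro!: continuous_intros)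
    show "0 \<le> \<Phi> s" for s by (simp add: \<Phi>_def sum_nonneg)
    show "(\<lambda>s. \<Sum>i\<in>UNIV. L i s) integrable_on {a..b}" using L by (intro integrable_sum) auto
    show "\<Phi> b = 0" using terminal by (simp add: \<Phi>_def)
    show "s \<in> {a..b}" by fact
  next
    fix s \<tau> M assume s: "a \<le> s" "s \<le> \<tau>" "\<tau> \<le> b" and "\<Phi> \<tau> = 0" and M: "\<And>r. r \<in> {s..\<tau>} \<Longrightarrow> \<Phi> r \<le> M"
    have sub: "{s..\<tau>} \<subseteq> {a..b}" using s by auto
    have Ls: "L i integrable_on {s..\<tau>}" for i using integrable_subinterval_real[OF L(1) sub] .
    have \<tau>: "y \<tau> i = z \<tau> i" for i
      using \<open>\<Phi> \<tau> = 0\<close> by (simp add: \<Phi>_def sum_nonneg_eq_0_iff)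
    have bound: "norm (y s i - z s i) \<le> M * integral {s..\<tau>} (L i)" for i
    proof -
      obtain N where N: "negligible N" and N_deriv: "\<And>r. r \<in> {a..b} - N \<Longrightarrow> \<exists>y' z'.
          ((\<lambda>s. y s i) has_vector_derivative y') (at r within {a..b}) \<and>
          ((\<lambda>s. z s i) has_vector_derivative z') (at r within {a..b}) \<and>
          norm (y' - z') \<le> L i r * \<Phi> r"
        using AE_lebesgue_on_negligible[OF deriv[of i], folded \<Phi>_def] by blast
      from N_deriv obtain y' z' where d: "\<And>r. r \<in> {a..b} - N \<Longrightarrow>
          ((\<lambda>s. y s i) has_vector_derivative y' r) (at r within {a..b}) \<and>
          ((\<lambda>s. z s i) has_vector_derivative z' r) (at r within {a..b}) \<and>
          norm (y' r - z' r) \<le> L i r * \<Phi> r"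
        by metis
      have "(y' has_integral y \<tau> i - y s i) {s..\<tau>}"
        using s sub d
        by (intro fundamental_theorem_of_calculus_abs_cont[OF _ abs_cont_on_subinterval[OF ac(1)] N])
           (auto intro: has_vector_derivative_within_subset[where S = "{a..b}"])
      moreover have "(z' has_integral z \<tau> i - z s i) {s..\<tau>}"
        using s sub d
        by (intro fundamental_theorem_of_calculus_abs_cont[OF _ abs_cont_on_subinterval[OF ac(2)] N])
           (auto intro: has_vector_derivative_within_subset[where S = "{a..b}"])
      ultimately have "((\<lambda>r. y' r - z' r) has_integral (y \<tau> i - y s i) - (z \<tau> i - z s i)) {s..\<tau>}"
        by (rule has_integral_diff)
      then have "((\<lambda>r. y' r - z' r) has_integral (z s i - y s i)) {s..\<tau>}" by (simp add: \<tau>)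
      \<comment> \<open>The derivative bound is known only off \<open>N\<close>; setting the
        integrand to 0 on \<open>N\<close> makes it hold at every point and leaves the integral
        unchanged.\<close>
      then have I: "((\<lambda>r. if r \<in> N then 0 else y' r - z' r) has_integral (z s i - y s i)) {s..\<tau>}"
        by (rule has_integral_spike[OF N, rotated]) auto
      have "norm (integral {s..\<tau>} (\<lambda>r. if r \<in> N then 0 else y' r - z' r)) \<le> integral {s..\<tau>} (\<lambda>r. M * L i r)"
      proof (rule Henstock_Kurzweil_Integration.integral_norm_bound_integral)
        show "(\<lambda>r. M * L i r) integrable_on {s..\<tau>}"
          using integrable_cmul[OF Ls, of M] by simp
        fix r assume r: "r \<in> {s..\<tau>}"
        have "0 \<le> \<Phi> r" by (simp add: \<Phi>_def sum_nonneg)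
        then have "0 \<le> L i r * \<Phi> r" "L i r * \<Phi> r \<le> M * L i r"
          using mult_left_mono[OF M[OF r], of "L i r"] L(2)[of r i] r sub by (auto simp: mult.commute)
        then show "norm (if r \<in> N then 0 else y' r - z' r) \<le> M * L i r"
          using d[of r] r sub by (auto split: if_splits intro: order_trans)
      qed (use I in blast)
      then show ?thesis
        using integral_unique[OF I] by (simp add: norm_minus_commute)
    qed
    have "\<Phi> s \<le> (\<Sum>i\<in>UNIV. M * integral {s..\<tau>} (L i))"
      unfolding \<Phi>_def by (intro sum_mono bound)
    also have "\<dots> = M * integral {s..\<tau>} (\<lambda>r. \<Sum>i\<in>UNIV. L i r)"
      using Ls by (simp add: integral_sum sum_distrib_left)
    finally show "\<Phi> s \<le> M * integral {s..\<tau>} (\<lambda>r. \<Sum>i\<in>UNIV. L i r)" .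
  qed
  then show ?thesis by (simp add: \<Phi>_def sum_nonneg_eq_0_iff)
qed

section \<open>Matrix norms and inverses\<close>

text \<open>The norm of a nested vector type is the Frobenius norm, so Cauchy-Schwarz on each row
  suffices.\<close>

lemma norm_matrix_vector_mult_le: "norm (A *v x) \<le> norm A * norm x" for A :: "real^'n^'m"
proof -
  have "norm ((A *v x) $ i) \<le> norm (A $ i) * norm x" for i
    by (simp add: matrix_vector_mul_component Cauchy_Schwarz_ineq2)
  then show ?thesis
    unfolding norm_vec_def[of "A *v x"] norm_vec_def[of A]
    by (subst L2_set_left_distrib) (auto intro: L2_set_mono)
qed

lemma norm_transpose: "norm (transpose A) = norm A" for A :: "real^'n^'m"
proof -
  have "(norm (transpose A))\<^sup>2 = (norm A)\<^sup>2"
    unfolding power2_norm_eq_inner inner_vec_def transpose_def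
    by (simp add: inner_vec_def) (rule sum.swap)
  then show ?thesis by simp
qed

text \<open>Row \<open>i\<close> of the product is \<open>transpose B\<close> applied to row
  \<open>i\<close> of \<open>A\<close>, which reduces the claim to the bound for matrix-vector
  products.\<close>

lemma norm_matrix_mult_le: "norm (A ** B) \<le> norm A * norm B" for A :: "real^'n^'m" and B :: "real^'k^'n"
proof -
  have "(A ** B) $ i = transpose B *v (A $ i)" for i
    by (simp add: vec_eq_iff matrix_matrix_mult_def matrix_vector_mult_def transpose_def mult.commute)
  then have "norm ((A ** B) $ i) \<le> norm (A $ i) * norm B" for i
    using norm_matrix_vector_mult_le[of "transpose B" "A $ i"] by (simp add: norm_transpose mult.commute)
  then show ?thesis
    unfolding norm_vec_def[of "A ** B"] norm_vec_def[of A]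
    by (subst L2_set_left_distrib) (auto intro: L2_set_mono)
qed

text \<open>A block collects the entries of \<open>x\<close> along an injection, so fewer squares
  are summed. Entries may themselves be vectors, which covers stacks of rows such as
  \<open>S_hat\<close>.\<close>

lemma norm_block_le:
  fixes x :: "'a::real_normed_vector ^ ('m::finite + 'v::finite)"
  shows "norm (block1 x) \<le> norm x" "norm (block2 x) \<le> norm x"
proof -
  have "L2_set (\<lambda>i. norm (x $ h i)) UNIV \<le> L2_set (\<lambda>k. norm (x $ k)) UNIV"
    if "inj h" for h :: "'c::finite \<Rightarrow> 'm + 'v"
    unfolding L2_set_def
    by (rule real_sqrt_le_mono, subst sum.reindex[OF that, symmetric, unfolded o_def]) (auto intro!: sum_mono2)
  from this[of Inl] this[of Inr] show "norm (block1 x) \<le> norm x" "norm (block2 x) \<le> norm x"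
    by (simp_all add: norm_vec_def block1_def block2_def)
qed

lemma norm_hcat_ge:
  fixes M :: "'a::real_normed_vector ^ 'm ^ 'n" and N :: "'a ^ 'v ^ 'n"
  shows "norm M \<le> norm (hcat M N)" "norm N \<le> norm (hcat M N)"
proof -
  have "M $ k = block1 (hcat M N $ k)" "N $ k = block2 (hcat M N $ k)" for k
    by (simp_all add: vec_eq_iff hcat_def vcat_def block1_def block2_def)
  then show "norm M \<le> norm (hcat M N)" "norm N \<le> norm (hcat M N)"
    unfolding norm_vec_def[of M] norm_vec_def[of N] norm_vec_def[of "hcat M N"]
    by (auto intro!: L2_set_mono norm_block_le)
qed

lemma matrix_inv_right: "A ** matrix_inv A = mat 1" if "invertible A" for A :: "real^'n^'n"
  using someI_ex[OF that[unfolded invertible_def]] by (simp add: matrix_inv_def)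

lemma matrix_inv_cancel:
  fixes A :: "real^'n^'n"
  assumes "invertible A"
  shows "A *v (matrix_inv A *v x) = x"
  using assms by (simp add: matrix_vector_mul_assoc matrix_inv_right)

lemma injective_imp_invertible:
  fixes A :: "real^'n^'n"
  assumes "\<And>x. A *v x = 0 \<Longrightarrow> x = 0"
  shows "invertible A"
  using assms by (metis invertible_left_inverse matrix_left_invertible_ker)

section \<open>Definite diagonal blocks and saddle point systems\<close>

lemma psd_diff_scaled_identity:
  assumes "psd (M - \<delta> *\<^sub>R mat 1)"
  shows "transpose M = M" "\<delta> * (norm x)\<^sup>2 \<le> x \<bullet> (M *v x)"
proof -
  have "transpose (M - \<delta> *\<^sub>R mat 1) = M - \<delta> *\<^sub>R mat 1" "0 \<le> x \<bullet> ((M - \<delta> *\<^sub>R mat 1) *v x)"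
    using assms by (simp_all add: psd_def symmetric_def)
  moreover have "transpose (M - \<delta> *\<^sub>R mat 1) = transpose M - \<delta> *\<^sub>R mat 1"
    by (simp add: vec_eq_iff transpose_def mat_def)
  moreover have "(M - \<delta> *\<^sub>R mat 1) *v x = M *v x - \<delta> *\<^sub>R x"
    by (simp add: matrix_vector_mult_diff_rdistrib scaleR_matrix_vector_assoc[symmetric])
  ultimately show "transpose M = M" "\<delta> * (norm x)\<^sup>2 \<le> x \<bullet> (M *v x)"
    by (simp_all add: inner_diff_right power2_norm_eq_inner)
qed

text \<open>Testing the block system with \<open>(u1, - u2)\<close> cancels the off-diagonal terms.\<close>

lemma saddle_point_estimate:
  fixes R11 :: "real^'m^'m" and R12 :: "real^'v^'m" and R22 :: "real^'v^'v"
  assumes "\<And>x. \<delta> * (norm x)\<^sup>2 \<le> x \<bullet> (R11 *v x)" "\<And>x. \<delta> * (norm x)\<^sup>2 \<le> - (x \<bullet> (R22 *v x))"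
    and "R11 *v u1 + R12 *v u2 = a" "transpose R12 *v u1 + R22 *v u2 = b"
  shows "\<delta> * ((norm u1)\<^sup>2 + (norm u2)\<^sup>2) \<le> norm a * norm u1 + norm b * norm u2"
proof -
  have "\<delta> * ((norm u1)\<^sup>2 + (norm u2)\<^sup>2) \<le> u1 \<bullet> (R11 *v u1) - u2 \<bullet> (R22 *v u2)"
    using assms(1)[of u1] assms(2)[of u2] by (simp add: distrib_left)
  also have "\<dots> = u1 \<bullet> a - u2 \<bullet> b"
  proof -
    have "u2 \<bullet> (transpose R12 *v u1) = u1 \<bullet> (R12 *v u2)"
      by (metis dot_lmul_matrix inner_commute transpose_matrix_vector)
    then show ?thesis by (simp flip: assms(3,4) add: inner_add_right)
  qed
  also have "\<dots> \<le> norm a * norm u1 + norm b * norm u2"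
    using norm_cauchy_schwarz[of u1 a] Cauchy_Schwarz_ineq2[of u2 b] by (simp add: mult.commute)
  finally show ?thesis .
qed

text \<open>Both the first and the second equation arise by block elimination in \<open>R u = \<theta>\<close>, the second one
  with the roles of the blocks exchanged.\<close>

lemma block_elimination:
  fixes R11 :: "real^'m^'m" and R12 :: "real^'v^'m" and R22 :: "real^'v^'v"
    and S1 :: "real^'n^'m" and S2 :: "real^'n^'v"
  assumes sym: "transpose R22 = R22" and inj: "\<And>x. R22 *v x = 0 \<Longrightarrow> x = 0"
    and block_inj: "\<And>u1 u2. \<lbrakk>R11 *v u1 + R12 *v u2 = 0; transpose R12 *v u1 + R22 *v u2 = 0\<rbrakk> \<Longrightarrow> u1 = 0"
  obtains u1 u2 where "R11 *v u1 + R12 *v u2 = \<theta>1" "transpose R12 *v u1 + R22 *v u2 = \<theta>2"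
    "transpose S2 *v (matrix_inv R22 *v \<theta>2)
      + transpose (S1 - R12 ** matrix_inv R22 ** S2)
          *v (matrix_inv (R11 - R12 ** matrix_inv R22 ** transpose R12) *v (\<theta>1 - R12 *v (matrix_inv R22 *v \<theta>2)))
     = transpose S1 *v u1 + transpose S2 *v u2"
proof -
  define J where "J = matrix_inv R22"
  have inv: "invertible R22" using inj by (rule injective_imp_invertible)
  have RJ: "R22 *v (J *v x) = x" for x using matrix_inv_cancel[OF inv] by (simp add: J_def)
  \<comment> \<open>The transpose of \<open>J\<close> is a left inverse of the symmetric
    \<open>R22\<close>, hence equal to its right inverse \<open>J\<close>.\<close>
  have Jsym: "transpose J = J"
  proof -
    have "transpose J ** R22 = mat 1"
      by (metis J_def inv matrix_inv_right matrix_transpose_mul sym transpose_mat)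
    then show ?thesis using inv
      by (metis J_def matrix_inv_right matrix_mul_assoc matrix_mul_lid matrix_mul_rid)
  qed
  \<comment> \<open>\<open>X\<close> is the Schur complement of \<open>R22\<close>.\<close>
  define X where "X = R11 - R12 ** J ** transpose R12"
  have Xv: "X *v x = R11 *v x - R12 *v (J *v (transpose R12 *v x))" for x
    by (simp add: X_def matrix_vector_mult_diff_rdistrib matrix_vector_mul_assoc matrix_mul_assoc
        del: transpose_matrix_vector)
  \<comment> \<open>By back substitution a kernel vector of \<open>X\<close> extends to a solution
    of the homogeneous block system, to which \<open>block_inj\<close> applies.\<close>
  have "invertible X"
  proof (rule injective_imp_invertible)
    fix x assume "X *v x = 0"
    then show "x = 0"
      by (intro block_inj[of x "- (J *v (transpose R12 *v x))"])
         (simp_all add: Xv RJ linear_neg[OF matrix_vector_mul_linear] del: transpose_matrix_vector)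
  qed
  \<comment> \<open>\<open>u1\<close> solves the system reduced to the Schur complement;
    \<open>u2\<close> then comes from the second block equation.\<close>
  define u1 where "u1 = matrix_inv X *v (\<theta>1 - R12 *v (J *v \<theta>2))"
  define u2 where "u2 = J *v (\<theta>2 - transpose R12 *v u1)"
  have "X *v u1 = \<theta>1 - R12 *v (J *v \<theta>2)"
    unfolding u1_def using \<open>invertible X\<close> by (rule matrix_inv_cancel)
  then have eq1: "R11 *v u1 + R12 *v u2 = \<theta>1"
    by (simp add: Xv u2_def matrix_vector_mult_diff_distrib algebra_simps)
  have eq2: "transpose R12 *v u1 + R22 *v u2 = \<theta>2" by (simp add: u2_def RJ)
  \<comment> \<open>By symmetry of \<open>J\<close>, the correction produced by this transpose is
    exactly the \<open>u1\<close> part of \<open>u2\<close>, up to the factor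
    \<open>transpose S2\<close>.\<close>
  have "transpose (S1 - R12 ** J ** S2) *v u1
      = transpose S1 *v u1 - transpose S2 *v (J *v (transpose R12 *v u1))"
  proof -
    have "transpose (S1 - X) = transpose S1 - transpose X" for X
      by (simp add: transpose_def vec_eq_iff)
    then have "transpose (S1 - R12 ** J ** S2) = transpose S1 - transpose S2 ** J ** transpose R12"
      using Jsym by (simp add: matrix_transpose_mul matrix_mul_assoc)
    then show ?thesis by (simp add: matrix_vector_mult_diff_rdistrib matrix_vector_mul_assoc matrix_mul_assoc
        del: transpose_matrix_vector)
  qed
  then have eq3: "transpose S2 *v (J *v \<theta>2) + transpose (S1 - R12 ** J ** S2) *v u1
      = transpose S1 *v u1 + transpose S2 *v u2"
    by (simp add: u2_def matrix_vector_mult_diff_distrib)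
  show ?thesis
    by (rule that[of u1 u2, folded J_def, folded X_def, folded u1_def, OF eq1 eq2 eq3])
qed

text \<open>Both diagonal blocks can thereby share one constant, the smaller of the two.\<close>

lemma psd_diff_mono:
  assumes "psd (M - \<delta> *\<^sub>R mat 1)" "\<epsilon> \<le> \<delta>"
  shows "psd (M - \<epsilon> *\<^sub>R mat 1)"
proof -
  have "\<epsilon> * (norm x)\<^sup>2 \<le> x \<bullet> (M *v x)" for x
    using psd_diff_scaled_identity(2)[OF assms(1), of x] mult_right_mono[OF assms(2), of "(norm x)\<^sup>2"] by simp
  moreover have "transpose (M - \<epsilon> *\<^sub>R mat 1) = transpose M - \<epsilon> *\<^sub>R mat 1"
    by (simp add: vec_eq_iff transpose_def mat_def)
  ultimately show ?thesis
    using psd_diff_scaled_identity(1)[OF assms(1)]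
    by (simp add: psd_def symmetric_def matrix_vector_mult_diff_rdistrib scaleR_matrix_vector_assoc[symmetric]
        inner_diff_right power2_norm_eq_inner)
qed

text \<open>Each feedback term is \<open>transpose S1 *v u1 + transpose S2 *v u2\<close> for a
  solution of the block system with its own right-hand side. By linearity the difference of the two
  solutions solves the system with right-hand sides \<open>transpose B1 *v x\<close> and
  \<open>transpose B2 *v x\<close>, so the saddle point estimate bounds it without estimating any
  inverse.\<close>

lemma block_feedback_difference:
  fixes R11 :: "real^'m^'m" and R12 :: "real^'v^'m" and R22 :: "real^'v^'v"
    and S1 :: "real^'n^'m" and S2 :: "real^'n^'v" and B1 :: "real^'m^'n" and B2 :: "real^'v^'n"
  assumes "\<delta> > 0" and pos: "psd (R11 - \<delta> *\<^sub>R mat 1)" and neg: "psd (- R22 - \<delta> *\<^sub>R mat 1)"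
    and S: "norm S1 \<le> \<alpha>" "norm S2 \<le> \<alpha>" and B: "norm B1 \<le> \<beta>" "norm B2 \<le> \<beta>"
    and \<theta>: "\<theta>1 - \<theta>1' = transpose B1 *v x" "\<theta>2 - \<theta>2' = transpose B2 *v x"
  shows "norm ((transpose S2 *v (matrix_inv R22 *v \<theta>2)
        + transpose (S1 - R12 ** matrix_inv R22 ** S2)
            *v (matrix_inv (R11 - R12 ** matrix_inv R22 ** transpose R12) *v (\<theta>1 - R12 *v (matrix_inv R22 *v \<theta>2))))
      - (transpose S1 *v (matrix_inv R11 *v \<theta>1')
        + transpose (S2 - transpose R12 ** matrix_inv R11 ** S1)
            *v (matrix_inv (R22 - transpose R12 ** matrix_inv R11 ** R12) *v (\<theta>2' - transpose R12 *v (matrix_inv R11 *v \<theta>1')))))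
    \<le> \<alpha> * (2 * \<beta> / \<delta>) * norm x"
    (is "norm (?X - ?Y) \<le> _")
proof -
  note [simp del] = transpose_matrix_vector
  have coercive: "\<delta> * (norm x)\<^sup>2 \<le> x \<bullet> (R11 *v x)" "\<delta> * (norm y)\<^sup>2 \<le> - (y \<bullet> (R22 *v y))" for x y
  proof -
    show "\<delta> * (norm x)\<^sup>2 \<le> x \<bullet> (R11 *v x)" by (rule psd_diff_scaled_identity(2)[OF pos])
    have "(- R22) *v y = - (R22 *v y)"
      using matrix_vector_mult_diff_rdistrib[of 0 R22 y] by simp
    then show "\<delta> * (norm y)\<^sup>2 \<le> - (y \<bullet> (R22 *v y))"
      using psd_diff_scaled_identity(2)[OF neg, of y] by simp
  qed
  have sym: "transpose R11 = R11" "transpose R22 = R22"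
  proof -
    show "transpose R11 = R11" by (rule psd_diff_scaled_identity(1)[OF pos])
    show "transpose R22 = R22"
      using psd_diff_scaled_identity(1)[OF neg] by (simp add: transpose_def vec_eq_iff)
  qed
  note estimate = saddle_point_estimate[of \<delta>, OF coercive]
  have inj: "R11 *v x = 0 \<Longrightarrow> x = 0" "R22 *v y = 0 \<Longrightarrow> y = 0" for x y
    using coercive(1)[of x] coercive(2)[of y] \<open>\<delta> > 0\<close> by (auto simp: mult_le_0_iff)
  have block_inj: "u1 = 0" "u2 = 0" if "R11 *v u1 + R12 *v u2 = 0" "transpose R12 *v u1 + R22 *v u2 = 0" for u1 u2
    using estimate[OF that] \<open>\<delta> > 0\<close>
    by (auto simp: mult_le_0_iff add_nonneg_eq_0_iff sum_power2_le_zero_iff)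
  obtain u1 u2 where u: "R11 *v u1 + R12 *v u2 = \<theta>1" "transpose R12 *v u1 + R22 *v u2 = \<theta>2"
    "?X = transpose S1 *v u1 + transpose S2 *v u2"
    by (rule block_elimination[OF sym(2) inj(2) block_inj(1), where ?\<theta>1.0 = \<theta>1 and ?\<theta>2.0 = \<theta>2
          and ?S1.0 = S1 and ?S2.0 = S2])
  \<comment> \<open>For the second term the blocks trade places: \<open>R11\<close> is eliminated,
    the off-diagonal block becomes \<open>transpose R12\<close>, and injectivity is read off for
    \<open>u2\<close>.\<close>
  have swapped: "u2 = 0" if "R22 *v u2 + transpose R12 *v u1 = 0" "transpose (transpose R12) *v u2 + R11 *v u1 = 0" for u1 u2
    using block_inj(2)[of u1 u2] that by (simp add: add.commute)
  obtain u1' u2' where u': "R11 *v u1' + R12 *v u2' = \<theta>1'" "transpose R12 *v u1' + R22 *v u2' = \<theta>2'"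
    "?Y = transpose S1 *v u1' + transpose S2 *v u2'"
  proof (rule block_elimination[OF sym(1) inj(1) swapped, where ?\<theta>1.0 = "\<theta>2'" and ?\<theta>2.0 = "\<theta>1'"
          and ?S1.0 = S2 and ?S2.0 = S1])
    fix u2 u1
    assume "R22 *v u2 + transpose R12 *v u1 = \<theta>2'" "transpose (transpose R12) *v u2 + R11 *v u1 = \<theta>1'"
      "transpose S1 *v (matrix_inv R11 *v \<theta>1') + transpose (S2 - transpose R12 ** matrix_inv R11 ** S1)
         *v (matrix_inv (R22 - transpose R12 ** matrix_inv R11 ** transpose (transpose R12))
            *v (\<theta>2' - transpose R12 *v (matrix_inv R11 *v \<theta>1')))
       = transpose S2 *v u2 + transpose S1 *v u1"
    then show thesis by (intro that[of u1 u2]) (simp_all add: add.commute)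
  qed
  define w1 w2 where w: "w1 = u1 - u1'" "w2 = u2 - u2'"
  have "R11 *v w1 + R12 *v w2 = transpose B1 *v x" "transpose R12 *v w1 + R22 *v w2 = transpose B2 *v x"
    using u(1,2) u'(1,2) by (auto simp: w matrix_vector_mult_diff_distrib algebra_simps simp flip: \<theta>)
  from estimate[OF this]
  have "\<delta> * ((norm w1)\<^sup>2 + (norm w2)\<^sup>2) \<le> norm (transpose B1 *v x) * norm w1 + norm (transpose B2 *v x) * norm w2" .
  also have "\<dots> \<le> (\<beta> * norm x) * norm w1 + (\<beta> * norm x) * norm w2"
  proof -
    have "norm (transpose B1 *v x) \<le> \<beta> * norm x" "norm (transpose B2 *v x) \<le> \<beta> * norm x"
      using B by (auto intro!: order_trans[OF norm_matrix_vector_mult_le] mult_right_mono simp: norm_transpose)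
    then show ?thesis by (intro add_mono mult_right_mono) auto
  qed
  \<comment> \<open>Doubling prepares for \<open>(a + b)^2 \<le> 2 * (a^2 + b^2)\<close>, which
    replaces the sum of squares by the square of the sum; hence the factor 2 in
    \<open>2 * \<beta> / \<delta>\<close>.\<close>
  finally have "\<delta> * (2 * ((norm w1)\<^sup>2 + (norm w2)\<^sup>2)) \<le> (2 * \<beta> * norm x) * (norm w1 + norm w2)"
    by (simp add: algebra_simps)
  moreover have "(norm w1 + norm w2)\<^sup>2 \<le> 2 * ((norm w1)\<^sup>2 + (norm w2)\<^sup>2)"
    using sum_squares_bound[of "norm w1" "norm w2"] by (simp add: power2_sum)
  ultimately have quad: "\<delta> * (norm w1 + norm w2)\<^sup>2 \<le> (2 * \<beta> * norm x) * (norm w1 + norm w2)"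
    using mult_left_mono[of _ _ \<delta>] \<open>\<delta> > 0\<close> by (meson less_imp_le order_trans)
  moreover have "\<beta> \<ge> 0" using B(1) norm_ge_zero[of B1] by linarith
  \<comment> \<open>One factor \<open>norm w1 + norm w2\<close> is cancelled when it is positive;
    when it is 0, nonnegativity of \<beta> suffices.\<close>
  ultimately have wle: "norm w1 + norm w2 \<le> 2 * \<beta> / \<delta> * norm x"
  proof (cases "norm w1 + norm w2 = 0")
    case False
    then have "norm w1 + norm w2 > 0" by (simp add: less_le)
    moreover have "(\<delta> * (norm w1 + norm w2)) * (norm w1 + norm w2) \<le> (2 * \<beta> * norm x) * (norm w1 + norm w2)"
      using quad by (simp add: power2_eq_square mult.assoc)
    ultimately have "\<delta> * (norm w1 + norm w2) \<le> 2 * \<beta> * norm x" by (rule mult_right_le_imp_le[rotated])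
    then show ?thesis using \<open>\<delta> > 0\<close> by (simp add: field_simps)
  qed (use \<open>\<delta> > 0\<close> in simp)
  have "?X - ?Y = transpose S1 *v w1 + transpose S2 *v w2"
    unfolding u(3) u'(3) by (simp add: w matrix_vector_mult_diff_distrib)
  also have "norm \<dots> \<le> norm S1 * norm w1 + norm S2 * norm w2"
    using norm_matrix_vector_mult_le[of "transpose S1" w1] norm_matrix_vector_mult_le[of "transpose S2" w2]
      norm_triangle_ineq[of "transpose S1 *v w1" "transpose S2 *v w2"] by (simp add: norm_transpose)
  also have "\<dots> \<le> \<alpha> * norm w1 + \<alpha> * norm w2"
    using S by (intro add_mono mult_right_mono) auto
  also have "\<dots> \<le> \<alpha> * (2 * \<beta> / \<delta> * norm x)"
    using mult_left_mono[OF wle, of \<alpha>] order_trans[OF norm_ge_zero S(1)] by (simp add: distrib_left)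
  finally show ?thesis by (simp only: mult.assoc)
qed

section \<open>Integrable bounds on the coefficients\<close>

text \<open>By \<open>2 * a * b \<le> a^2 + b^2\<close> the product is dominated by the sum of the
  squares. Applied to products of \<open>cB\<close> with the square integrable coefficients that
  control \<open>S_hat\<close>.\<close>

lemma L2_mult_integrable:
  assumes "L2 T f" "L2 T g"
  shows "integrable (lebesgue_on {0..T}) (\<lambda>s. norm (f s) * norm (g s))"
proof (rule Bochner_Integration.integrable_bound)
  show "integrable (lebesgue_on {0..T}) (\<lambda>s. (norm (f s))\<^sup>2 + (norm (g s))\<^sup>2)"
    using assms by (simp add: L2_def)
  show "(\<lambda>s. norm (f s) * norm (g s)) \<in> borel_measurable (lebesgue_on {0..T})"
    using assms by (auto simp: L2_def intro!: borel_measurable_times borel_measurable_norm)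
  have "norm (f s) * norm (g s) \<le> (norm (f s))\<^sup>2 + (norm (g s))\<^sup>2" for s
    using sum_squares_bound[of "norm (f s)" "norm (g s)"] mult_nonneg_nonneg[OF norm_ge_zero norm_ge_zero, of "f s" "g s"]
    by linarith
  then show "AE s in lebesgue_on {0..T}. norm (norm (f s) * norm (g s)) \<le> norm ((norm (f s))\<^sup>2 + (norm (g s))\<^sup>2)"
    by (auto simp: abs_mult intro!: AE_I2)
qed

lemma cont_paths_bounded:
  fixes y :: "real \<Rightarrow> 'k \<Rightarrow> 'a::real_normed_vector"
  assumes "cont_paths t T y"
  obtains M where "\<And>s. s \<in> {t..T} \<Longrightarrow> norm (y s i) \<le> M"
proof -
  have "bounded ((\<lambda>s. y s i) ` {t..T})"
    using assms by (intro compact_imp_bounded compact_continuous_image) (auto simp: cont_paths_def)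
  then obtain M where "\<forall>s\<in>{t..T}. norm (y s i) \<le> M" by (auto simp: bounded_iff)
  then show ?thesis using that by blast
qed

text \<open>Controls \<open>S_hat\<close> by square integrable coefficients with constant weights:
  continuity bounds the Riccati functions by \<open>M\<close>, and essential boundedness bounds
  \<open>cD\<close> and \<open>cDb\<close> by \<open>K\<close>.\<close>

lemma norm_S_hat_le:
  fixes c :: "('n::finite, 'm::finite, 'v::finite, 'k) coeffs"
  assumes "norm (P s i) \<le> M" "norm (PI s i) \<le> M" "norm (cD c s i) \<le> K" "norm (cDb c s i) \<le> K"
  shows "norm (S_hat c PI P s i)
    \<le> M * norm (cB c s i) + K * M * norm (cC c s i) + K * M * norm (cCb c s i) + norm (cS c s i)"
proof -
  have "0 \<le> M" "0 \<le> K" using assms by (meson norm_ge_zero order_trans)+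
  have D: "norm (transpose D ** X ** C) \<le> K * M * norm C"
    if "norm D \<le> K" "norm X \<le> M" for D :: "real^('m + 'v)^'n" and X C :: "real^'n^'n"
  proof -
    have "norm (transpose D ** X ** C) \<le> norm (transpose D ** X) * norm C" by (rule norm_matrix_mult_le)
    also have "\<dots> \<le> norm D * norm X * norm C"
      using norm_matrix_mult_le[of "transpose D" X] by (intro mult_right_mono) (auto simp: norm_transpose)
    also have "\<dots> \<le> K * M * norm C"
      using that \<open>0 \<le> K\<close> by (intro mult_right_mono mult_mono) auto
    finally show ?thesis .
  qed
  have "norm (transpose (cB c s i) ** P s i) \<le> norm (cB c s i) * norm (P s i)"
    using norm_matrix_mult_le[of "transpose (cB c s i)" "P s i"] by (simp add: norm_transpose)
  also have "\<dots> \<le> norm (cB c s i) * M" using assms(1) by (intro mult_left_mono) auto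
  finally show ?thesis
    unfolding S_hat_def using assms
    by (intro norm_add_rule_thm D) (auto simp: mult.commute)
qed

section \<open>Comparison of the two equations\<close>

text \<open>Here \<open>a + b\<close> and \<open>a' + b'\<close> stand for the feedback terms and
  \<open>p\<close>, \<open>q\<close>, \<open>r\<close>, \<open>h\<close> for the inhomogeneities,
  which are common to both equations and cancel. In the remaining terms each single difference is at
  most the sum over all regimes.\<close>

lemma drift_difference:
  fixes A :: "real^'n^'n" and y z :: "'k::finite \<Rightarrow> real^'n"
  assumes "y' + transpose A *v y i - a - b + p + q + r + h + (\<Sum>j\<in>UNIV. l j *\<^sub>R y j) = 0"
    and "z' + transpose A *v z i - a' - b' + p + q + r + h + (\<Sum>j\<in>UNIV. l j *\<^sub>R z j) = 0"
    and X: "norm ((a + b) - (a' + b')) \<le> \<kappa> * norm (y i - z i)" and "0 \<le> \<kappa>"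
  shows "norm (y' - z') \<le> (norm A + \<kappa> + (\<Sum>j\<in>UNIV. \<bar>l j\<bar>)) * (\<Sum>j\<in>UNIV. norm (y j - z j))"
proof -
  define \<Sigma> where "\<Sigma> = (\<Sum>j\<in>UNIV. norm (y j - z j))"
  have le: "norm (y j - z j) \<le> \<Sigma>" for j
    unfolding \<Sigma>_def by (rule member_le_sum) auto
  have y': "y' = (a + b) - transpose A *v y i - (p + q + r + h) - (\<Sum>j\<in>UNIV. l j *\<^sub>R y j)"
    using assms(1) by (simp add: algebra_simps eq_neg_iff_add_eq_0 del: transpose_matrix_vector)
  have z': "z' = (a' + b') - transpose A *v z i - (p + q + r + h) - (\<Sum>j\<in>UNIV. l j *\<^sub>R z j)"
    using assms(2) by (simp add: algebra_simps eq_neg_iff_add_eq_0 del: transpose_matrix_vector)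
  have "y' - z' = ((a + b) - (a' + b')) - transpose A *v (y i - z i) - (\<Sum>j\<in>UNIV. l j *\<^sub>R (y j - z j))"
    unfolding y' z' by (simp add: matrix_vector_mult_diff_distrib scaleR_diff_right sum_subtractf del: transpose_matrix_vector)
  then have "norm (y' - z') \<le> norm ((a + b) - (a' + b')) + norm (transpose A *v (y i - z i)) + norm (\<Sum>j\<in>UNIV. l j *\<^sub>R (y j - z j))"
    by (simp only:) (intro norm_triangle_le_diff add_mono norm_triangle_ineq4 order_refl)
  also have "\<dots> \<le> \<kappa> * \<Sigma> + norm A * \<Sigma> + (\<Sum>j\<in>UNIV. \<bar>l j\<bar>) * \<Sigma>"
  proof (intro add_mono)
    show "norm ((a + b) - (a' + b')) \<le> \<kappa> * \<Sigma>"
      using X mult_left_mono[OF le \<open>0 \<le> \<kappa>\<close>] by (rule order_trans)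
    have "norm (transpose A *v (y i - z i)) \<le> norm A * norm (y i - z i)"
      using norm_matrix_vector_mult_le[of "transpose A" "y i - z i"] by (simp only: norm_transpose)
    also have "\<dots> \<le> norm A * \<Sigma>" by (rule mult_left_mono[OF le]) simp
    finally show "norm (transpose A *v (y i - z i)) \<le> norm A * \<Sigma>" .
    have "norm (\<Sum>j\<in>UNIV. l j *\<^sub>R (y j - z j)) \<le> (\<Sum>j\<in>UNIV. \<bar>l j\<bar> * \<Sigma>)"
      by (rule sum_norm_le) (simp add: le mult_left_mono)
    then show "norm (\<Sum>j\<in>UNIV. l j *\<^sub>R (y j - z j)) \<le> (\<Sum>j\<in>UNIV. \<bar>l j\<bar>) * \<Sigma>"
      by (simp add: sum_distrib_right)
  qed
  finally show ?thesis by (simp add: \<Sigma>_def algebra_simps)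
qed

lemma AE_Linf_bound:
  fixes t T :: real
  assumes "Linf T f" "0 \<le> t"
  obtains K where "AE s in lebesgue_on {t..T}. norm (f s) \<le> K"
proof -
  obtain K where "AE s in lebesgue_on {0..T}. norm (f s) \<le> K" using assms(1) by (auto simp: Linf_def)
  then show ?thesis using that[of K] AE_lebesgue_on_subset[where c = 0 and d = T and a = t and b = T] assms(2) by auto
qed

text \<open>Supplies the integrable coefficient for \<open>backward_ode_unique\<close>. The feedback
  contributes \<open>\<alpha> s * (2 * norm (cB c s i) / \<delta>)\<close>, a product of two square
  integrable functions; the drift matrix and the generator row add \<open>norm (cA c s i)\<close>
  and a constant.\<close>

lemma eta_difference_bound:
  fixes c :: "('n::finite, 'm::finite, 'v::finite, 'k::finite) coeffs"
  assumes "0 \<le> t" and c: "standing_assumptions T c"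
    and PI: "cont_paths t T PI" and P: "cont_paths t T P"
    and pos: "unif_pos t T (\<lambda>s. block11 (R_hat c \<gamma> PI P s i))"
    and neg: "unif_neg t T (\<lambda>s. block22 (R_hat c \<gamma> PI P s i))"
    and \<eta>: "eta_equation c lam \<gamma> t T PI P \<eta>" and \<eta>b: "eta_bar_equation c lam \<gamma> t T PI P \<eta>b"
  shows "\<exists>L. L integrable_on {t..T} \<and> (\<forall>s. 0 \<le> L s) \<and>
    (AE s in lebesgue_on {t..T}. \<exists>y' z'.
        ((\<lambda>s. \<eta> s i) has_vector_derivative y') (at s within {t..T}) \<and>
        ((\<lambda>s. \<eta>b s i) has_vector_derivative z') (at s within {t..T}) \<and>
        norm (y' - z') \<le> L s * (\<Sum>j\<in>UNIV. norm (\<eta> s j - \<eta>b s j)))"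
proof -
  obtain \<delta>1 where \<delta>1: "\<delta>1 > 0" "AE s in lebesgue_on {t..T}. psd (block11 (R_hat c \<gamma> PI P s i) - \<delta>1 *\<^sub>R mat 1)"
    using pos by (auto simp: unif_pos_def)
  obtain \<delta>2 where \<delta>2: "\<delta>2 > 0" "AE s in lebesgue_on {t..T}. psd (- block22 (R_hat c \<gamma> PI P s i) - \<delta>2 *\<^sub>R mat 1)"
    using neg by (auto simp: unif_pos_def unif_neg_def)
  define \<delta> where "\<delta> = min \<delta>1 \<delta>2"
  have "\<delta> > 0" using \<delta>1(1) \<delta>2(1) by (simp add: \<delta>_def)
  obtain M1 where M1: "\<And>s. s \<in> {t..T} \<Longrightarrow> norm (P s i) \<le> M1" using cont_paths_bounded[OF P, of i] by blast
  obtain M2 where M2: "\<And>s. s \<in> {t..T} \<Longrightarrow> norm (PI s i) \<le> M2" using cont_paths_bounded[OF PI, of i] by blast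
  \<comment> \<open>The maximum with 0, here and in \<open>K\<close>, gives nonnegativity without
    referring to a point of the interval, so that \<open>L\<close> is nonnegative
    everywhere.\<close>
  define M where "M = max 0 (max M1 M2)"
  have M: "norm (P s i) \<le> M" "norm (PI s i) \<le> M" if "s \<in> {t..T}" for s
    using M1[OF that] M2[OF that] by (auto simp: M_def)
  obtain K1 where K1: "AE s in lebesgue_on {t..T}. norm (cD c s i) \<le> K1"
    using AE_Linf_bound[of T "\<lambda>s. cD c s i" t] c \<open>0 \<le> t\<close> by (auto simp: standing_assumptions_def)
  obtain K2 where K2: "AE s in lebesgue_on {t..T}. norm (cDb c s i) \<le> K2"
    using AE_Linf_bound[of T "\<lambda>s. cDb c s i" t] c \<open>0 \<le> t\<close> by (auto simp: standing_assumptions_def)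
  define K where "K = max 0 (max K1 K2)"
  have nonneg: "0 \<le> M" "0 \<le> K" by (simp_all add: M_def K_def)
  define \<alpha> where "\<alpha> s = M * norm (cB c s i) + K * M * norm (cC c s i) + K * M * norm (cCb c s i) + norm (cS c s i)" for s
  have \<alpha>: "0 \<le> \<alpha> s" for s using nonneg by (simp add: \<alpha>_def)
  define L where "L s = norm (cA c s i) + \<alpha> s * (2 * norm (cB c s i) / \<delta>) + (\<Sum>j\<in>UNIV. \<bar>lam i j\<bar>)" for s
  \<comment> \<open>Expanded so that every product pairs two square integrable norms and
    \<open>L2_mult_integrable\<close> applies termwise.\<close>
  have L_eq: "L s = norm (cA c s i) + (\<Sum>j\<in>UNIV. \<bar>lam i j\<bar>)
      + 2 / \<delta> * (M * (norm (cB c s i) * norm (cB c s i)) + K * M * (norm (cC c s i) * norm (cB c s i))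
        + K * M * (norm (cCb c s i) * norm (cB c s i)) + norm (cS c s i) * norm (cB c s i))" for s
    by (simp add: L_def \<alpha>_def algebra_simps add_divide_distrib)
  have coeffs: "L1 T (\<lambda>s. cA c s i)" "L2 T (\<lambda>s. cB c s i)" "L2 T (\<lambda>s. cC c s i)" "L2 T (\<lambda>s. cCb c s i)" "L2 T (\<lambda>s. cS c s i)"
    using c by (auto simp: standing_assumptions_def)
  have "integrable (lebesgue_on {0..T}) L"
    unfolding L_eq
    using coeffs(1) by (intro Bochner_Integration.integrable_add integrable_mult_right L2_mult_integrable coeffs integrable_norm)
      (auto simp: L1_def)
  then have "integrable (lebesgue_on {t..T}) L"
    by (rule Equivalence_Lebesgue_Henstock_Integration.integrable_subinterval) (use \<open>0 \<le> t\<close> in auto)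
  then have "L integrable_on {t..T}" by (rule integrable_on_lebesgue_on) simp
  moreover have "0 \<le> L s" for s
    using \<alpha>[of s] \<open>\<delta> > 0\<close> by (auto simp: L_def intro!: add_nonneg_nonneg sum_nonneg)
  moreover have "AE s in lebesgue_on {t..T}. \<exists>y' z'.
        ((\<lambda>s. \<eta> s i) has_vector_derivative y') (at s within {t..T}) \<and>
        ((\<lambda>s. \<eta>b s i) has_vector_derivative z') (at s within {t..T}) \<and>
        norm (y' - z') \<le> L s * (\<Sum>j\<in>UNIV. norm (\<eta> s j - \<eta>b s j))"
    using \<eta>[unfolded eta_equation_def ode_solution_def Let_def, THEN spec[of _ i], THEN conjunct1, THEN conjunct2]
      \<eta>b[unfolded eta_bar_equation_def ode_solution_def Let_def, THEN spec[of _ i], THEN conjunct1, THEN conjunct2]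
      \<delta>1(2) \<delta>2(2) K1 K2 AE_space
  proof eventually_elim
    case (elim s)
    then have s: "s \<in> {t..T}" by simp
    \<comment> \<open>Reduces the goal to a bound for arbitrary values satisfying the two equations;
      the abstract predicates spare writing the equations out.\<close>
    have combine: "\<exists>y' z'. D1 y' \<and> D2 z' \<and> Q y' z'"
      if "\<exists>y'. D1 y' \<and> E1 y'" "\<exists>z'. D2 z' \<and> E2 z'" "\<And>y' z'. \<lbrakk>E1 y'; E2 z'\<rbrakk> \<Longrightarrow> Q y' z'"
      for D1 D2 E1 E2 :: "real^'n \<Rightarrow> bool" and Q
      using that by blast
    have "norm (cD c s i) \<le> K" "norm (cDb c s i) \<le> K" using elim(5,6) by (auto simp: K_def)
    then have S: "norm (S_hat c PI P s i) \<le> \<alpha> s"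
      unfolding \<alpha>_def using M[OF s] by (intro norm_S_hat_le)
    have R11: "psd (block11 (R_hat c \<gamma> PI P s i) - \<delta> *\<^sub>R mat 1)"
      using elim(3) by (rule psd_diff_mono) (simp add: \<delta>_def)
    have R22: "psd (- block22 (R_hat c \<gamma> PI P s i) - \<delta> *\<^sub>R mat 1)"
      using elim(4) by (rule psd_diff_mono) (simp add: \<delta>_def)
    have S1: "norm (block1 (S_hat c PI P s i)) \<le> \<alpha> s" and S2: "norm (block2 (S_hat c PI P s i)) \<le> \<alpha> s"
      using S norm_block_le[of "S_hat c PI P s i"] by linarith+
    have B1: "norm (cB1 c s i) \<le> norm (cB c s i)" and B2: "norm (cB2 c s i) \<le> norm (cB c s i)"
      unfolding cB_def by (rule norm_hcat_ge)+
    \<comment> \<open>The data terms of the right-hand sides agree in both equations, so their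
      differences reduce to \<open>transpose (cB1 c s i) *v (\<eta> s i - \<eta>b s i)\<close> and
      its analogue for \<open>cB2\<close>.\<close>
    show ?case
      unfolding L_def
      by (rule combine[OF elim(1,2)],
          rule drift_difference[OF _ _ block_feedback_difference[OF \<open>\<delta> > 0\<close> R11 R22 S1 S2 B1 B2]],
          assumption, assumption)
        (use \<alpha>[of s] \<open>\<delta> > 0\<close> in \<open>simp_all add: matrix_vector_mult_diff_distrib del: transpose_matrix_vector\<close>)
  qed
  ultimately show ?thesis by blast
qed


theorem proposition4p1:
  fixes c :: "('n::finite, 'm::finite, 'v::finite, 'k::finite) coeffs"
    and lam :: "'k \<Rightarrow> 'k \<Rightarrow> real"
    and t T \<gamma> :: real
    and PI P :: "real \<Rightarrow> 'k \<Rightarrow> real ^ 'n ^ 'n"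
    and \<eta> \<eta>b :: "real \<Rightarrow> 'k \<Rightarrow> real ^ 'n"
  assumes "0 \<le> t" and "t < T" and "0 < \<gamma>"
    and "generator lam"
    and "standing_assumptions T c"
    and "cont_paths t T PI" and "\<forall>s\<in>{t..T}. \<forall>i. symmetric (PI s i)"
    and "cont_paths t T P" and "\<forall>s\<in>{t..T}. \<forall>i. symmetric (P s i)"
    and "riccati_PI c lam \<gamma> t T PI"
    and "riccati_P c lam \<gamma> t T PI P"
    and "\<forall>i. unif_pos t T (\<lambda>s. block11 (R_hat c \<gamma> PI P s i))"
    and "\<forall>i. unif_neg t T (\<lambda>s. block22 (R_hat c \<gamma> PI P s i))"
    and "cont_paths t T \<eta>" and "eta_equation c lam \<gamma> t T PI P \<eta>"
    and "cont_paths t T \<eta>b" and "eta_bar_equation c lam \<gamma> t T PI P \<eta>b"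
  shows "\<forall>s\<in>{t..T}. \<forall>i. \<eta> s i = \<eta>b s i"
proof (intro ballI allI)
  fix s i assume "s \<in> {t..T}"
  let ?bound = "\<lambda>i L. L integrable_on {t..T} \<and> (\<forall>s. 0 \<le> L s) \<and>
    (AE s in lebesgue_on {t..T}. \<exists>y' z'.
        ((\<lambda>s. \<eta> s i) has_vector_derivative y') (at s within {t..T}) \<and>
        ((\<lambda>s. \<eta>b s i) has_vector_derivative z') (at s within {t..T}) \<and>
        norm (y' - z') \<le> L s * (\<Sum>j\<in>UNIV. norm (\<eta> s j - \<eta>b s j)))"
  have "\<forall>i. \<exists>L. ?bound i L"
    using assms by (intro allI eta_difference_bound) auto
  \<comment> \<open>One coefficient is chosen per regime, giving the family that
    \<open>backward_ode_unique\<close> takes.\<close>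
  then have "\<exists>L. \<forall>i. ?bound i (L i)" by (rule choice)
  then obtain L where L: "\<forall>i. ?bound i (L i)" ..
  show "\<eta> s i = \<eta>b s i"
  proof (rule backward_ode_unique[of t T \<eta> \<eta>b L])
    show "abs_cont_on t T (\<lambda>s. \<eta> s i)" "\<eta> T i = \<eta>b T i" "abs_cont_on t T (\<lambda>s. \<eta>b s i)" for i
      using assms by (simp_all add: eta_equation_def eta_bar_equation_def ode_solution_def)
  qed (use assms L[THEN spec] \<open>s \<in> {t..T}\<close> in \<open>simp_all only:\<close>)
qed

end
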